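(* Let $V_{1,H}\subset\prod_{k\in I_1}\mathcal F$ and $V_{2,H}\subset\prod_{k\in I_2}\mathcal F$ be finite-dimensional subspaces, let $m_{ij},a_{ij},c_{ij}$ ($i,j\in\{1,2\}$) be the bilinear forms defined in the context, and let $\gamma$ be the constant defined in the context. Let $\tau>0$ and let $(U_1^n)_{n\ge 0}\subset V_{1,H}$, $(U_2^n)_{n\ge0}\subset V_{2,H}$ satisfy, for every $n\ge 1$, the following scheme (discretization scheme 2 with zero source): for all $W_1\in V_{1,H}$, $$m_{11}\Big(\frac{U_1^{n+1}-U_1^n}{\tau},W_1\Big)+m_{12}\Big(\frac{U_2^{n}-U_2^{n-1}}{\tau},W_1\Big)+a_{11}(U_1^{n+1},W_1)+a_{12}(U_2^n,W_1)+c_{11}(U_1^{n+1},W_1)+c_{12}(U_2^{n},W_1)=0,$$ and for all $W_2\in V_{2,H}$, $$m_{22}\Big(\frac{U_2^{n+1}-U_2^n}{\tau},W_2\Big)+m_{21}\Big(\frac{U_1^{n}-U_1^{n-1}}{\tau},W_2\Big)+a_{21}(U_1^{n+1},W_2)+a_{22}(U_2^n,W_2)+c_{21}(U_1^{n+1},W_2)+c_{22}(U_2^{n},W_2)=0.$$ If $$\tau\le(1-\gamma^2)\inf_{W\in V_{2,H}}\frac{\|W\|_{m_{22}}^2}{\|W\|_{a_{22}}^2+\|W\|_{c_{22}}^2},$$ then for every $n\ge1$ $$\frac{\gamma^2}{\tau}\sum_{i=1}^2\|U_i^{n+1}-U_i^n\|_{m_{ii}}^2+\|(U_1^{n+1},U_2^{n+1})\|_a^2+\|(U_1^{n+1},U_2^{n+1})\|_c^2\le\frac{\gamma^2}{\tau}\sum_{i=1}^2\|U_i^{n}-U_i^{n-1}\|_{m_{ii}}^2+\|(U_1^{n},U_2^{n})\|_a^2+\|(U_1^{n},U_2^{n})\|_c^2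 .$$
   Context: Setting. $\Omega\subset\mathbb R^d$ ($d=2,3$) is a bounded polygonal domain and $\kappa:\Omega\to\mathbb R$ satisfies $0<\min\kappa\le\kappa(x)\le\max\kappa<\infty$. $\Omega$ is partitioned by a regular coarse mesh $\mathcal T_H$; $I_H$ is the set of centers of the coarse blocks and $K_H(x_l)$ is the block with center $x_l\in I_H$. $(\cdot,\cdot)$ and $\|\cdot\|$ are the $L^2(\Omega)$ inner product and norm, and $a(u,v)=\int_\Omega\kappa\nabla u\cdot\nabla v$, where for functions that are only piecewise regular on the coarse mesh the gradients are taken block by block. Continua and basis functions. There are $N$ continua with given auxiliary functions $\psi_1,\dots,\psi_N$ (e.g. characteristic functions of the continua). For each coarse block $K=K_H(x_l)$, let $K^+$ be an oversampled region around $K$ composed of coarse blocks $K^p$, with $K=K^{p_0}$, and write $\psi_j^p$ for $\psi_j$ on $K^p$. The functions $\phi_i=\phi_i^{K}$ and $\phi_i^m=\phi_i^{K,m}$ ($1\le i\le N$, $1\le m\le d$), in the local energy space on $K^+$ (contained in $H^1(K^+)$), solve, with Lagrange multipliers $\mu$ and for all test functions $v$ in the local energy space: (1) $\int_{K^+}\kappa\nabla\phi_i\cdot\nabla v-\sum_{j,p}\frac{\mu_{ij}^p}{\int_{K^p}\psi_j^p}\int_{K^p}\psi_j^pv=0$ and $\int_{K^p}\phi_i\psi_j^p=\delta_{ij}\int_{K^p}\psi_j^p$ for all $j,p$; (2) $\int_{K^+}\kappa\nabla\phi_i^m\cdot\nabla v-\sum_{j,p}\frac{\mu_{ij}^{mp}}{\int_{K^p}\psi_j^p}\int_{K^p}\psi_j^pv=0$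 and $\int_{K^p}\phi_i^m\psi_j^p=\delta_{ij}\int_{K^p}(x_m-\tilde x_m)\psi_j^p$ for all $j,p$, where the constant $\tilde x_m$ is such that $\int_{K^{p_0}}(x_m-\tilde x_m)\psi_j^{p_0}=0$. Write $\tilde\phi_i^{K}=(\phi_i^{K,m})_{1\le m\le d}$. Spaces and maps. $\mathcal F=\mathcal F(\Omega)$ is a vector space of sufficiently smooth functions on $\Omega$ (e.g. $H^{1+\alpha}_0(\Omega)$ for some $\alpha\in(0,1]$). $I_1,I_2$ are disjoint sets with $I_1\cup I_2=\{1,\dots,N\}$. For $j=1,2$ and $U=(U_i)_{i\in I_j}\in\prod_{i\in I_j}\mathcal F$ define $$T_{j,0}U=\sum_{i\in I_j}\sum_{x_l\in I_H}\mathbf 1_{K_H(x_l)}\phi_i^{K_H(x_l)}U_i,\qquad T_{j,1}U=\sum_{i\in I_j}\sum_{x_l\in I_H}\mathbf 1_{K_H(x_l)}\tilde\phi_i^{K_H(x_l)}\cdot\nabla U_i,\qquad T_j=T_{j,0}+T_{j,1},$$ and $V_j=T_j\big(\prod_{i\in I_j}\mathcal F\big)$. The multicontinuum space is the direct sum $V_1\oplus V_2$; in particular $V_1\cap V_2=\{0\}$. The finite-dimensional spaces $V_{j,H}$ (e.g. Lagrange finite element spaces) are regular enough that all forms below are defined on them, and $T_j(V_{j,H})\subset L^2(\Omega)$. Forms and norms. For $U\in\prod_{k\in I_j}\mathcal F$ and $W\in\prod_{k\in I_i}\mathcal F$, $$m_{ij}(U,W)=(T_jU,T_iW),\quad a_{ij}(U,W)=a(T_{j,1}U,T_{i,1}W),\quad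 c_{ij}(U,W)=a(T_{j,0}U,T_{i,0}W).$$ $\|W\|_{m_{ii}}^2=m_{ii}(W,W)$, $\|W\|_{a_{ii}}^2=a_{ii}(W,W)$, $\|W\|_{c_{ii}}^2=c_{ii}(W,W)$, and $$\|(U_1,U_2)\|_a^2=\sum_{i,j}a_{ij}(U_j,U_i)=a\Big(\sum_iT_{i,1}U_i,\sum_iT_{i,1}U_i\Big),\qquad\|(U_1,U_2)\|_c^2=\sum_{i,j}c_{ij}(U_j,U_i)=a\Big(\sum_iT_{i,0}U_i,\sum_iT_{i,0}U_i\Big).$$ The constant $\gamma$ is $$\gamma=\sup_{U_1\in V_{1,H},\,U_2\in V_{2,H}}\frac{(T_1U_1,T_2U_2)}{\|T_1U_1\|\,\|T_2U_2\|}$$ (supremum over pairs with nonzero denominator); by $V_1\cap V_2=\{0\}$ and finite dimensionality, $\gamma<1$. The infimum of quotients over $V_{2,H}$ is over $W$ with nonzero denominator. *)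

theory Defs
  imports "HOL-Analysis.Analysis" "HOL-Library.Function_Algebras"
begin

section \<open>Function spaces\<close>

text \<open>
  Functions on a set S are represented by total functions whose values outside S are irrelevant.
\<close>

global_interpretation scalar_fun: vector_space "\<lambda>(c::real) (f::'a \<Rightarrow> real) x. c * f x"
  by (unfold_locales; simp add: fun_eq_iff distrib_left distrib_right)

global_interpretation vector_fun:
  vector_space "\<lambda>(c::real) (U::'k \<Rightarrow> 'a \<Rightarrow> real) k x. c * U k x"
  by (unfold_locales; simp add: fun_eq_iff distrib_left distrib_right)

definition sq_integrable :: "'a::euclidean_space set \<Rightarrow> ('a \<Rightarrow> 'b::euclidean_space) \<Rightarrow> bool" where
  "sq_integrable S f \<longleftrightarrow>
     set_borel_measurable lebesgue S f \<and> set_integrable lebesgue S (\<lambda>x. (norm (f x))\<^sup>2)"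

definition loc_integrable :: "'a::euclidean_space set \<Rightarrow> ('a \<Rightarrow> 'b::euclidean_space) \<Rightarrow> bool" where
  "loc_integrable S f \<longleftrightarrow> (\<forall>C. compact C \<and> C \<subseteq> S \<longrightarrow> set_integrable lebesgue C f)"

text \<open>
  Test functions are \<open>C\<^sup>1\<close> with compact support in S (as in Brezis); by mollification this gives
  the same weak gradients as smooth test functions. \<open>G\<close> is the gradient of \<open>\<phi>\<close>.
\<close>

definition test_function :: "'a::euclidean_space set \<Rightarrow> ('a \<Rightarrow> real) \<Rightarrow> ('a \<Rightarrow> 'a) \<Rightarrow> bool" where
  "test_function S \<phi> G \<longleftrightarrow>
     (\<forall>x. GDERIV \<phi> x :> G x) \<and> continuous_on UNIV G \<and>
     compact (closure {x. \<phi> x \<noteq> 0}) \<and> closure {x. \<phi> x \<noteq> 0} \<subseteq> S"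

definition has_weak_gradient ::
    "'a::euclidean_space set \<Rightarrow> ('a \<Rightarrow> real) \<Rightarrow> ('a \<Rightarrow> 'a) \<Rightarrow> bool" where
  "has_weak_gradient S u g \<longleftrightarrow>
     loc_integrable S u \<and> loc_integrable S g \<and>
     (\<forall>\<phi> G. test_function S \<phi> G \<longrightarrow>
        (LINT x:S|lebesgue. u x *\<^sub>R G x) = - (LINT x:S|lebesgue. \<phi> x *\<^sub>R g x))"

text \<open>For open S the weak gradient is unique up to a null set; one representative is chosen.\<close>

definition weak_gradient :: "'a::euclidean_space set \<Rightarrow> ('a \<Rightarrow> real) \<Rightarrow> 'a \<Rightarrow> 'a" where
  "weak_gradient S u = (SOME g. has_weak_gradient S u g)"

definition H1 :: "'a::euclidean_space set \<Rightarrow> ('a \<Rightarrow> real) set" where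
  "H1 S = {u. sq_integrable S u \<and> (\<exists>g. has_weak_gradient S u g \<and> sq_integrable S g)}"

section \<open>Domain and coarse mesh\<close>

definition polygonal_domain :: "'a::euclidean_space set \<Rightarrow> bool" where
  "polygonal_domain S \<longleftrightarrow> S \<noteq> {} \<and> connected S \<and>
     (\<exists>P. finite P \<and> (\<forall>p\<in>P. polytope p) \<and> S = interior (\<Union>P))"

text \<open>
  The blocks are closed convex polytopes meeting face to face, and are indexed by their
  centers; of a center only its position inside the block is used.
\<close>

definition coarse_mesh ::
    "'a::euclidean_space set \<Rightarrow> 'a set \<Rightarrow> ('a \<Rightarrow> 'a set) \<Rightarrow> bool" where
  "coarse_mesh S C K \<longleftrightarrow>
     finite C \<and> closure S = (\<Union>l\<in>C. K l) \<and>
     (\<forall>l\<in>C. polytope (K l) \<and> l \<in> interior (K l)) \<and>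
     (\<forall>l\<in>C. \<forall>l'\<in>C. l \<noteq> l' \<longrightarrow>
        interior (K l) \<inter> interior (K l') = {} \<and>
        K l \<inter> K l' face_of K l \<and> K l \<inter> K l' face_of K l')"

section \<open>Multicontinuum data\<close>

text \<open>
  \<open>centers\<close> is the index set of the blocks, \<open>over l\<close> the set of centers of the blocks making up
  the oversampled region around \<open>block l\<close>, and \<open>lspace l\<close> the local energy space on that region.
  \<open>phi l i\<close> is the i-th basis function for block l, and \<open>phig l i\<close> the vector of the d basis
  functions belonging to the gradient (its component m constrained by the coordinate m).
  \<open>smooth\<close> is the space of smooth functions on the domain.
\<close>

record ('d::finite) multicontinuum =
  omega :: "(real^'d) set"
  coeff :: "real^'d \<Rightarrow> real"
  centers :: "(real^'d) set"
  block :: "real^'d \<Rightarrow> (real^'d) set"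
  over :: "real^'d \<Rightarrow> (real^'d) set"
  lspace :: "real^'d \<Rightarrow> (real^'d \<Rightarrow> real) set"
  ncont :: nat
  psi :: "nat \<Rightarrow> real^'d \<Rightarrow> real"
  phi :: "real^'d \<Rightarrow> nat \<Rightarrow> real^'d \<Rightarrow> real"
  phig :: "real^'d \<Rightarrow> nat \<Rightarrow> real^'d \<Rightarrow> real^'d"
  smooth :: "(real^'d \<Rightarrow> real) set"
  part :: "nat \<Rightarrow> nat set"

definition over_region :: "('d::finite) multicontinuum \<Rightarrow> real^'d \<Rightarrow> (real^'d) set" where
  "over_region M l = (\<Union>p\<in>over M l. block M p)"

definition energy_on ::
    "('d::finite) multicontinuum \<Rightarrow> (real^'d) set \<Rightarrow> (real^'d \<Rightarrow> real) \<Rightarrow> (real^'d \<Rightarrow> real) \<Rightarrow> real" where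
  "energy_on M S u v =
     (LINT x:S|lebesgue. coeff M x * (weak_gradient (interior S) u x \<bullet> weak_gradient (interior S) v x))"

text \<open>The variational equation common to both families of basis functions; \<open>\<mu>\<close> are the multipliers.\<close>

definition cell_equation :: "('d::finite) multicontinuum \<Rightarrow> real^'d \<Rightarrow> (real^'d \<Rightarrow> real) \<Rightarrow> bool" where
  "cell_equation M l u \<longleftrightarrow>
     (\<exists>\<mu>::nat \<Rightarrow> real^'d \<Rightarrow> real. \<forall>v\<in>lspace M l.
        energy_on M (over_region M l) u v
        - (\<Sum>j\<in>{1..ncont M}. \<Sum>p\<in>over M l.
             \<mu> j p / (LINT x:block M p|lebesgue. psi M j x)
               * (LINT x:block M p|lebesgue. psi M j x * v x)) = 0)"

definition average_basis :: "('d::finite) multicontinuum \<Rightarrow> real^'d \<Rightarrow> nat \<Rightarrow> bool" where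
  "average_basis M l i \<longleftrightarrow>
     phi M l i \<in> lspace M l \<and> cell_equation M l (phi M l i) \<and>
     (\<forall>j\<in>{1..ncont M}. \<forall>p\<in>over M l.
        (LINT x:block M p|lebesgue. phi M l i x * psi M j x) =
        (if i = j then LINT x:block M p|lebesgue. psi M j x else 0))"

text \<open>
  The normalization of the constant \<open>c j\<close> involves \<open>\<psi>\<^sub>j\<close>, so the constant may vary with j.
\<close>

definition gradient_basis :: "('d::finite) multicontinuum \<Rightarrow> real^'d \<Rightarrow> nat \<Rightarrow> 'd \<Rightarrow> bool" where
  "gradient_basis M l i m \<longleftrightarrow>
     (\<lambda>x. phig M l i x $ m) \<in> lspace M l \<and> cell_equation M l (\<lambda>x. phig M l i x $ m) \<and>
     (\<exists>c::nat \<Rightarrow> real.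
        (\<forall>j\<in>{1..ncont M}. (LINT x:block M l|lebesgue. (x $ m - c j) * psi M j x) = 0) \<and>
        (\<forall>j\<in>{1..ncont M}. \<forall>p\<in>over M l.
           (LINT x:block M p|lebesgue. phig M l i x $ m * psi M j x) =
           (if i = j then LINT x:block M p|lebesgue. (x $ m - c j) * psi M j x else 0)))"

definition prod_space :: "('d::finite) multicontinuum \<Rightarrow> nat \<Rightarrow> (nat \<Rightarrow> real^'d \<Rightarrow> real) set" where
  "prod_space M j = Pi (part M j) (\<lambda>_. smooth M)"

text \<open>Blocks are closed, so on the (null) mesh skeleton several summands may be present.\<close>

definition T0 :: "('d::finite) multicontinuum \<Rightarrow> nat \<Rightarrow> (nat \<Rightarrow> real^'d \<Rightarrow> real) \<Rightarrow> real^'d \<Rightarrow> real" where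
  "T0 M j U x = (\<Sum>i\<in>part M j. \<Sum>l\<in>centers M. indicator (block M l) x * (phi M l i x * U i x))"

definition T1 :: "('d::finite) multicontinuum \<Rightarrow> nat \<Rightarrow> (nat \<Rightarrow> real^'d \<Rightarrow> real) \<Rightarrow> real^'d \<Rightarrow> real" where
  "T1 M j U x = (\<Sum>i\<in>part M j. \<Sum>l\<in>centers M.
     indicator (block M l) x * (phig M l i x \<bullet> weak_gradient (omega M) (U i) x))"

definition T :: "('d::finite) multicontinuum \<Rightarrow> nat \<Rightarrow> (nat \<Rightarrow> real^'d \<Rightarrow> real) \<Rightarrow> real^'d \<Rightarrow> real" where
  "T M j U x = T0 M j U x + T1 M j U x"

definition mc_space :: "('d::finite) multicontinuum \<Rightarrow> nat \<Rightarrow> (real^'d \<Rightarrow> real) set" where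
  "mc_space M j = T M j ` prod_space M j"

text \<open>
  The last clause says that the two spaces intersect trivially, functions being identified
  when they agree almost everywhere.
\<close>

definition multicontinuum_setting :: "('d::finite) multicontinuum \<Rightarrow> bool" where
  "multicontinuum_setting M \<longleftrightarrow>
     CARD('d) \<in> {2, 3} \<and>
     polygonal_domain (omega M) \<and>
     set_borel_measurable lebesgue (omega M) (coeff M) \<and>
     (\<exists>k0>0. \<exists>k1. \<forall>x\<in>omega M. k0 \<le> coeff M x \<and> coeff M x \<le> k1) \<and>
     coarse_mesh (omega M) (centers M) (block M) \<and>
     (\<forall>l\<in>centers M. l \<in> over M l \<and> over M l \<subseteq> centers M) \<and>
     (\<forall>j\<in>{1..ncont M}. sq_integrable (omega M) (psi M j) \<and>
        (\<forall>l\<in>centers M. (LINT x:block M l|lebesgue. psi M j x) \<noteq> 0)) \<and>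
     (\<forall>l\<in>centers M. scalar_fun.subspace (lspace M l) \<and>
        lspace M l \<subseteq> H1 (interior (over_region M l))) \<and>
     (\<forall>l\<in>centers M. \<forall>i\<in>{1..ncont M}. average_basis M l i \<and> (\<forall>m. gradient_basis M l i m)) \<and>
     scalar_fun.subspace (smooth M) \<and> smooth M \<subseteq> H1 (omega M) \<and>
     part M 1 \<inter> part M 2 = {} \<and> part M 1 \<union> part M 2 = {1..ncont M} \<and>
     (\<forall>u\<in>mc_space M 1. \<forall>v\<in>mc_space M 2.
        (AE x in lebesgue_on (omega M). u x = v x) \<longrightarrow> (AE x in lebesgue_on (omega M). u x = 0))"

text \<open>
  Finite-dimensional coarse spaces, regular enough for the forms below to be defined: the images
  under \<open>T0\<close> and \<open>T1\<close> are \<open>H\<^sup>1\<close> on every block, and those under \<open>T\<close> are square integrable.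
\<close>

definition coarse_space ::
    "('d::finite) multicontinuum \<Rightarrow> nat \<Rightarrow> (nat \<Rightarrow> real^'d \<Rightarrow> real) set \<Rightarrow> bool" where
  "coarse_space M j V \<longleftrightarrow>
     V \<subseteq> prod_space M j \<and> (\<exists>B. finite B \<and> V = vector_fun.span B) \<and>
     (\<forall>U\<in>V. sq_integrable (omega M) (T M j U) \<and>
        (\<forall>l\<in>centers M. T0 M j U \<in> H1 (interior (block M l)) \<and>
                        T1 M j U \<in> H1 (interior (block M l))))"

section \<open>Forms and norms\<close>

definition L2_inner :: "('d::finite) multicontinuum \<Rightarrow> (real^'d \<Rightarrow> real) \<Rightarrow> (real^'d \<Rightarrow> real) \<Rightarrow> real" where
  "L2_inner M u v = (LINT x:omega M|lebesgue. u x * v x)"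

definition L2_norm :: "('d::finite) multicontinuum \<Rightarrow> (real^'d \<Rightarrow> real) \<Rightarrow> real" where
  "L2_norm M u = sqrt (L2_inner M u u)"

definition energy :: "('d::finite) multicontinuum \<Rightarrow> (real^'d \<Rightarrow> real) \<Rightarrow> (real^'d \<Rightarrow> real) \<Rightarrow> real" where
  "energy M u v = (\<Sum>l\<in>centers M. energy_on M (block M l) u v)"

definition mform :: "('d::finite) multicontinuum \<Rightarrow> nat \<Rightarrow> nat \<Rightarrow>
    (nat \<Rightarrow> real^'d \<Rightarrow> real) \<Rightarrow> (nat \<Rightarrow> real^'d \<Rightarrow> real) \<Rightarrow> real" where
  "mform M i j U W = L2_inner M (T M j U) (T M i W)"

definition aform :: "('d::finite) multicontinuum \<Rightarrow> nat \<Rightarrow> nat \<Rightarrow>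
    (nat \<Rightarrow> real^'d \<Rightarrow> real) \<Rightarrow> (nat \<Rightarrow> real^'d \<Rightarrow> real) \<Rightarrow> real" where
  "aform M i j U W = energy M (T1 M j U) (T1 M i W)"

definition cform :: "('d::finite) multicontinuum \<Rightarrow> nat \<Rightarrow> nat \<Rightarrow>
    (nat \<Rightarrow> real^'d \<Rightarrow> real) \<Rightarrow> (nat \<Rightarrow> real^'d \<Rightarrow> real) \<Rightarrow> real" where
  "cform M i j U W = energy M (T0 M j U) (T0 M i W)"

text \<open>Squared norms; the pair is given as a family \<open>U 1, U 2\<close>.\<close>

definition anorm2 :: "('d::finite) multicontinuum \<Rightarrow> (nat \<Rightarrow> nat \<Rightarrow> real^'d \<Rightarrow> real) \<Rightarrow> real" where
  "anorm2 M U = (\<Sum>i\<in>{1,2}. \<Sum>j\<in>{1,2}. aform M i j (U j) (U i))"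

definition cnorm2 :: "('d::finite) multicontinuum \<Rightarrow> (nat \<Rightarrow> nat \<Rightarrow> real^'d \<Rightarrow> real) \<Rightarrow> real" where
  "cnorm2 M U = (\<Sum>i\<in>{1,2}. \<Sum>j\<in>{1,2}. cform M i j (U j) (U i))"

text \<open>
  The quotients are symmetric about 0, so inserting 0 only matters when no quotient is
  defined; it then fixes the convention that the supremum is 0.
\<close>

definition gamma_const ::
    "('d::finite) multicontinuum \<Rightarrow> (nat \<Rightarrow> (nat \<Rightarrow> real^'d \<Rightarrow> real) set) \<Rightarrow> real" where
  "gamma_const M V = Sup (insert 0
     {L2_inner M (T M 1 U1) (T M 2 U2) / (L2_norm M (T M 1 U1) * L2_norm M (T M 2 U2)) | U1 U2.
        U1 \<in> V 1 \<and> U2 \<in> V 2 \<and> L2_norm M (T M 1 U1) * L2_norm M (T M 2 U2) \<noteq> 0})"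

text \<open>Extended real valued, so that the infimum over no quotients is infinite.\<close>

definition inf_quotient ::
    "('d::finite) multicontinuum \<Rightarrow> (nat \<Rightarrow> real^'d \<Rightarrow> real) set \<Rightarrow> ereal" where
  "inf_quotient M V2 =
     (INF W\<in>{W\<in>V2. aform M 2 2 W W + cform M 2 2 W W \<noteq> 0}.
        ereal (mform M 2 2 W W / (aform M 2 2 W W + cform M 2 2 W W)))"

definition diff_quot ::
    "real \<Rightarrow> ('k \<Rightarrow> 'a \<Rightarrow> real) \<Rightarrow> ('k \<Rightarrow> 'a \<Rightarrow> real) \<Rightarrow> 'k \<Rightarrow> 'a \<Rightarrow> real" where
  "diff_quot \<tau> U W = (\<lambda>k x. (U k x - W k x) / \<tau>)"

end

(*
  Testing the scheme with the increments W_i = U_i^{n+1} - U_i^n and adding the two equations gives,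
  with A = a + c, the exact balance
    |U^{n+1}|_A^2 - |U^n|_A^2 + |W_1|_A^2 - |W_2|_A^2 + (2/tau) (|W_1|_m^2 + |W_2|_m^2)
      + (2/tau) (m(U_2^n - U_2^{n-1}, W_1) + m(U_1^n - U_1^{n-1}, W_2)) = 0.
  The mixed mass terms are controlled by gamma and Young's inequality, and the step size restriction
  absorbs |W_2|_A^2, the only remaining term of the wrong sign.

  The forms are bilinear only because weak gradients, which are chosen by SOME, are additive up to null
  sets. This rests on their uniqueness, i.e. on the du Bois-Reymond lemma: indicators of boxes are
  dominated pointwise limits of C^1 test functions, so a locally integrable function orthogonal to all
  test functions has vanishing box averages and is zero by Lebesgue differentiation.
*)

theory Submission
  imports Defs
begin

section \<open>Square integrable functions\<close>

text \<open>Lebesgue measure is complete, so measurability passes along equality almost everywhere;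
  if neither function is measurable, both integrals have the default value 0.\<close>

lemma lebesgue_integral_cong_AE:
  fixes f g :: "'a::euclidean_space \<Rightarrow> 'b::euclidean_space"
  assumes eq: "AE x in lebesgue. f x = g x"
  shows "integral\<^sup>L lebesgue f = integral\<^sup>L lebesgue g"
proof (cases "f \<in> borel_measurable lebesgue")
  case True
  then show ?thesis using borel_measurable_AE[OF True eq] eq by (intro integral_cong_AE)
next
  case False
  have "AE x in lebesgue. g x = f x" using eq by eventually_elim simp
  then have "g \<notin> borel_measurable lebesgue" using False borel_measurable_AE by blast
  then show ?thesis using False
    by (metis borel_measurable_integrable not_integrable_integral_eq)
qed

lemma set_lebesgue_integral_cong_AE_lebesgue:
  fixes f g :: "'a::euclidean_space \<Rightarrow> 'b::euclidean_space"
  assumes "AE x in lebesgue. x \<in> S \<longrightarrow> f x = g x"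
  shows "(LINT x:S|lebesgue. f x) = (LINT x:S|lebesgue. g x)"
  unfolding set_lebesgue_integral_def
  by (rule lebesgue_integral_cong_AE, use assms in eventually_elim) (auto simp: indicator_def)

lemma set_lebesgue_integral_cong_set_AE:
  fixes f :: "'a::euclidean_space \<Rightarrow> 'b::euclidean_space"
  assumes "AE x in lebesgue. x \<in> S \<longleftrightarrow> x \<in> S'"
  shows "(LINT x:S|lebesgue. f x) = (LINT x:S'|lebesgue. f x)"
  unfolding set_lebesgue_integral_def
  by (rule lebesgue_integral_cong_AE, use assms in eventually_elim) (auto simp: indicator_def)

text \<open>Cauchy-Schwarz and Young's inequality dominate the integrand by a constant times the sum
  of the squared norms. With \<open>c\<close> the coefficient and \<open>f\<close>, \<open>g\<close>
  weak gradients, this is the existence of the energy integrals.\<close>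

lemma set_integrable_weighted_inner:
  fixes f g :: "'a::euclidean_space \<Rightarrow> 'b::euclidean_space"
  assumes f: "sq_integrable S f" and g: "sq_integrable S g"
    and c: "set_borel_measurable lebesgue S c" "\<And>x. x \<in> S \<Longrightarrow> \<bar>c x\<bar> \<le> k"
  shows "set_integrable lebesgue S (\<lambda>x. c x * (f x \<bullet> g x))"
proof -
  \<comment> \<open>Each factor is truncated separately, because measurability is given only for the
    truncated functions.\<close>
  let ?F = "\<lambda>x. indicator S x *\<^sub>R f x" and ?G = "\<lambda>x. indicator S x *\<^sub>R g x"
  have meas: "?F \<in> borel_measurable lebesgue" "?G \<in> borel_measurable lebesgue"
    "(\<lambda>x. indicator S x *\<^sub>R c x) \<in> borel_measurable lebesgue"
    using f g c(1) unfolding sq_integrable_def set_borel_measurable_def by auto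
  have "integrable lebesgue (\<lambda>x. indicator S x *\<^sub>R (norm (f x))\<^sup>2 + indicator S x *\<^sub>R (norm (g x))\<^sup>2)"
    using f g unfolding sq_integrable_def set_integrable_def by (intro Bochner_Integration.integrable_add) auto
  then have "integrable lebesgue (\<lambda>x. \<bar>k\<bar> * (indicator S x *\<^sub>R (norm (f x))\<^sup>2 + indicator S x *\<^sub>R (norm (g x))\<^sup>2))"
    by (rule integrable_mult_right)
  then have "integrable lebesgue (\<lambda>x. (indicator S x *\<^sub>R c x) * (?F x \<bullet> ?G x))"
  proof (rule Bochner_Integration.integrable_bound)
    show "(\<lambda>x. (indicator S x *\<^sub>R c x) * (?F x \<bullet> ?G x)) \<in> borel_measurable lebesgue"
      using meas by (intro borel_measurable_times borel_measurable_inner)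
    show "AE x in lebesgue. norm ((indicator S x *\<^sub>R c x) * (?F x \<bullet> ?G x))
      \<le> norm (\<bar>k\<bar> * (indicator S x *\<^sub>R (norm (f x))\<^sup>2 + indicator S x *\<^sub>R (norm (g x))\<^sup>2))"
    proof (rule AE_I2)
      fix x
      show "norm ((indicator S x *\<^sub>R c x) * (?F x \<bullet> ?G x))
        \<le> norm (\<bar>k\<bar> * (indicator S x *\<^sub>R (norm (f x))\<^sup>2 + indicator S x *\<^sub>R (norm (g x))\<^sup>2))"
      proof (cases "x \<in> S")
        case True
        have "\<bar>f x \<bullet> g x\<bar> \<le> norm (f x) * norm (g x)" by (rule Cauchy_Schwarz_ineq2)
        also have "\<dots> \<le> (norm (f x))\<^sup>2 + (norm (g x))\<^sup>2"
          using sum_squares_bound[of "norm (f x)" "norm (g x)"]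
            mult_nonneg_nonneg[OF norm_ge_zero[of "f x"] norm_ge_zero[of "g x"]] by linarith
        finally have "\<bar>c x\<bar> * \<bar>f x \<bullet> g x\<bar> \<le> \<bar>k\<bar> * ((norm (f x))\<^sup>2 + (norm (g x))\<^sup>2)"
          using c(2)[OF True] by (intro mult_mono) auto
        then show ?thesis using True by (simp add: abs_mult)
      qed simp
    qed
  qed
  moreover have "(indicator S x *\<^sub>R c x) * (?F x \<bullet> ?G x) = indicator S x *\<^sub>R (c x * (f x \<bullet> g x))" for x
    by (auto simp: indicator_def)
  ultimately show ?thesis unfolding set_integrable_def by (simp only:)
qed

lemma set_integrable_mult_sq:
  fixes f g :: "'a::euclidean_space \<Rightarrow> real"
  assumes "S \<in> sets lebesgue" "sq_integrable S f" "sq_integrable S g"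
  shows "set_integrable lebesgue S (\<lambda>x. f x * g x)"
  using set_integrable_weighted_inner[OF assms(2,3), of "\<lambda>_. 1" 1] assms(1)
  by (simp add: set_borel_measurable_def)

lemma sq_integrable_cong_AE:
  fixes f g :: "'a::euclidean_space \<Rightarrow> 'b::euclidean_space"
  assumes "AE x in lebesgue. x \<in> S \<longrightarrow> f x = g x" "sq_integrable S f"
  shows "sq_integrable S g"
proof -
  have 1: "AE x in lebesgue. indicator S x *\<^sub>R f x = indicator S x *\<^sub>R g x"
    and 2: "AE x in lebesgue. indicator S x *\<^sub>R (norm (f x))\<^sup>2 = indicator S x *\<^sub>R (norm (g x))\<^sup>2"
    using assms(1) by (auto elim!: eventually_mono simp: indicator_def)
  have f: "(\<lambda>x. indicator S x *\<^sub>R f x) \<in> borel_measurable lebesgue"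
    "integrable lebesgue (\<lambda>x. indicator S x *\<^sub>R (norm (f x))\<^sup>2)"
    using assms(2) unfolding sq_integrable_def set_borel_measurable_def set_integrable_def by auto
  show ?thesis
    unfolding sq_integrable_def set_borel_measurable_def set_integrable_def
    using borel_measurable_AE[OF f(1) 1]
      integrable_cong_AE[THEN iffD1, OF borel_measurable_integrable[OF f(2)]
        borel_measurable_AE[OF borel_measurable_integrable[OF f(2)] 2] 2 f(2)] by blast
qed

lemma quadratic_discriminant_le:
  fixes A B C :: real
  assumes "\<And>r s. 0 \<le> r\<^sup>2 * A + 2 * r * s * B + s\<^sup>2 * C"
  shows "B\<^sup>2 \<le> A * C"
proof (cases "C = 0")
  case True
  have "B = 0"
  proof (rule ccontr)
    assume "B \<noteq> 0"
    \<comment> \<open>With \<open>C = 0\<close> the form is affine in \<open>s\<close> at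
      \<open>r = 1\<close>, and this \<open>s\<close> gives it the value -1.\<close>
    then show False using assms[of 1 "- (A + 1) / (2 * B)"] True by (simp add: field_simps)
  qed
  then show ?thesis using True by simp
next
  case False
  then have "C > 0" using assms[of 0 1] by simp
  \<comment> \<open>For \<open>r = C\<close> the form is minimal at \<open>s = - B\<close>, and this
    product is its value there.\<close>
  have "0 \<le> C * (A * C - B\<^sup>2)"
    using assms[of C "- B"] by (simp add: power2_eq_square algebra_simps)
  then show ?thesis using \<open>C > 0\<close> by (simp add: zero_le_mult_iff)
qed

section \<open>Uniqueness and linearity of weak gradients\<close>

definition C1 :: "('a::euclidean_space \<Rightarrow> real) \<Rightarrow> bool" where
  "C1 f \<longleftrightarrow> (\<exists>G. (\<forall>x. GDERIV f x :> G x) \<and> continuous_on UNIV G)"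

lemma GDERIV_continuous: "\<forall>x. GDERIV f x :> G x \<Longrightarrow> continuous_on UNIV f"
  by (metis continuous_at_imp_continuous_on gderiv_def has_derivative_continuous)

lemma C1_mult:
  assumes "C1 f" "C1 g" shows "C1 (\<lambda>x. f x * g x)"
proof -
  obtain F G where F: "\<forall>x. GDERIV f x :> F x" "continuous_on UNIV F"
    and G: "\<forall>x. GDERIV g x :> G x" "continuous_on UNIV G"
    using assms unfolding C1_def by blast
  have "continuous_on UNIV f" "continuous_on UNIV g"
    by (rule GDERIV_continuous[OF F(1)], rule GDERIV_continuous[OF G(1)])
  then have "continuous_on UNIV (\<lambda>x. f x *\<^sub>R G x + g x *\<^sub>R F x)"
    using F(2) G(2) by (intro continuous_intros)
  moreover have "\<forall>x. GDERIV (\<lambda>x. f x * g x) x :> f x *\<^sub>R G x + g x *\<^sub>R F x"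
    using F(1) G(1) by (intro allI GDERIV_mult) auto
  ultimately show ?thesis unfolding C1_def by (intro exI conjI)
qed

lemma C1_prod:
  assumes "finite A" "\<And>i. i \<in> A \<Longrightarrow> C1 (f i)"
  shows "C1 (\<lambda>x. \<Prod>i\<in>A. f i x)"
  using assms
proof (induction A rule: finite_induct)
  case empty
  show ?case unfolding C1_def using GDERIV_const by (auto intro!: exI[of _ "\<lambda>_. 0"])
next
  case (insert i A)
  then show ?case by (simp add: C1_mult)
qed

text \<open>The outer derivative is asked for only on \<open>range f\<close>, so that an outer
  function with a pole away from that range, such as \<open>n t / (1 + n t)\<close> on nonnegative
  \<open>t\<close>, can be composed.\<close>

lemma C1_compose:
  fixes h :: "real \<Rightarrow> real"
  assumes "C1 f" "\<And>t. t \<in> range f \<Longrightarrow> DERIV h t :> h' t" "continuous_on (range f) h'"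
  shows "C1 (\<lambda>x. h (f x))"
proof -
  obtain F where F: "\<forall>x. GDERIV f x :> F x" "continuous_on UNIV F"
    using assms unfolding C1_def by blast
  have "continuous_on UNIV (\<lambda>x. h' (f x) *\<^sub>R F x)"
    using F GDERIV_continuous[OF F(1)] assms(3)
    by (intro continuous_intros continuous_on_compose2[OF assms(3)]) auto
  moreover have "\<forall>x. GDERIV (\<lambda>x. h (f x)) x :> h' (f x) *\<^sub>R F x"
    using F(1) assms(2) by (intro allI GDERIV_DERIV_compose) auto
  ultimately show ?thesis unfolding C1_def by (intro exI conjI)
qed

text \<open>Squaring smooths the kink of the positive part: at 0 the difference quotient is bounded
  by \<open>\<bar>h\<bar>\<close>; elsewhere the function is locally the square or 0.\<close>

lemma DERIV_max0_square: "((\<lambda>t::real. (max 0 t)\<^sup>2) has_real_derivative 2 * max 0 t) (at t)"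
proof (cases "t = 0")
  case True
  have "((\<lambda>h. (max 0 h)\<^sup>2 / h) \<longlongrightarrow> (0::real)) (at 0)"
  proof (rule Lim_null_comparison)
    show "\<forall>\<^sub>F h::real in at 0. norm ((max 0 h)\<^sup>2 / h) \<le> \<bar>h\<bar>"
      by (auto simp: max_def power2_eq_square)
    show "((\<lambda>h::real. \<bar>h\<bar>) \<longlongrightarrow> 0) (at 0)"
      by (rule tendsto_eq_intros refl | simp)+
  qed
  then show ?thesis by (simp add: DERIV_def True)
next
  case False
  show ?thesis
  proof (cases "t > 0")
    case True
    have "((\<lambda>t. t\<^sup>2) has_real_derivative 2 * t) (at t)"
      by (rule derivative_eq_intros refl | simp)+
    then have "((\<lambda>t. (max 0 t)\<^sup>2) has_real_derivative 2 * t) (at t)"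
      by (rule DERIV_cong_ev[THEN iffD1, rotated 3, OF _ refl _ refl])
         (use True in \<open>auto intro!: eventually_mono[OF eventually_nhds_in_open[of "{0<..}"]]\<close>)
    then show ?thesis using True by simp
  next
    case neg: False
    have "((\<lambda>t. 0) has_real_derivative 0) (at t)" by simp
    then have "((\<lambda>t. (max 0 t)\<^sup>2) has_real_derivative 0) (at t)"
      by (rule DERIV_cong_ev[THEN iffD1, rotated 3, OF _ refl _ refl])
         (use neg False in \<open>auto intro!: eventually_mono[OF eventually_nhds_in_open[of "{..<0}"]]\<close>)
    then show ?thesis using neg by simp
  qed
qed

lemma C1_max0_square: "C1 f \<Longrightarrow> C1 (\<lambda>x. (max 0 (f x))\<^sup>2)"
  by (rule C1_compose[where h = "\<lambda>t. (max 0 t)\<^sup>2", OF _ DERIV_max0_square]) (auto intro!: continuous_intros)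

lemma C1_affine: "C1 (\<lambda>x::'a::euclidean_space. x \<bullet> i + c)"
  unfolding C1_def gderiv_def
  by (rule exI[of _ "\<lambda>_. i"]) (auto intro!: derivative_eq_intros)

text \<open>The bump multiplies the squared positive parts of the signed distances to all faces of
  the box; the product is nonzero exactly where every distance is positive.\<close>

lemma C1_box_bump:
  fixes a b :: "'a::euclidean_space"
  obtains p where "C1 p" "\<And>x. p x \<ge> 0" "\<And>x. p x \<noteq> 0 \<longleftrightarrow> x \<in> box a b"
proof
  let ?p = "\<lambda>x. \<Prod>i\<in>Basis. (max 0 (x \<bullet> i + - (a \<bullet> i)))\<^sup>2 * (max 0 (x \<bullet> (- i) + b \<bullet> i))\<^sup>2"
  show "C1 ?p"
    by (intro C1_prod C1_mult C1_max0_square C1_affine) auto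
  show "?p x \<ge> 0" for x by (intro prod_nonneg) auto
  show "?p x \<noteq> 0 \<longleftrightarrow> x \<in> box a b" for x
  proof -
    have 1: "(max 0 s)\<^sup>2 * (max 0 t)\<^sup>2 \<noteq> 0 \<longleftrightarrow> s > 0 \<and> t > 0" for s t :: real
      by (auto simp: max_def)
    have "?p x \<noteq> 0 \<longleftrightarrow> (\<forall>i\<in>Basis. x \<bullet> i + - (a \<bullet> i) > 0 \<and> x \<bullet> (- i) + b \<bullet> i > 0)"
      unfolding prod_zero_iff[OF finite_Basis] using 1 by blast
    then show ?thesis by (simp add: mem_box)
  qed
qed

text \<open>The bound and the pointwise limit are what dominated convergence needs to turn
  orthogonality to all test functions into vanishing integrals over boxes.\<close>

lemma test_functions_tendsto_box:
  fixes a b :: "'a::euclidean_space"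
  assumes "cbox a b \<subseteq> S"
  obtains \<phi> G where "\<And>n::nat. test_function S (\<phi> n) (G n)"
    "\<And>n x. \<bar>\<phi> n x\<bar> \<le> indicator (cbox a b) x"
    "\<And>x. (\<lambda>n. \<phi> n x) \<longlonglongrightarrow> indicator (box a b) x"
proof -
  obtain p where p: "C1 p" "\<And>x. p x \<ge> 0" "\<And>x. p x \<noteq> 0 \<longleftrightarrow> x \<in> box a b"
    using C1_box_bump[of a b] by metis
  \<comment> \<open>The map \<open>t / (1 + t)\<close> sends nonnegative numbers into [0, 1) and
    fixes 0; scaling \<open>p\<close> by \<open>n\<close> pushes the value to 1 wherever
    \<open>p\<close> is positive.\<close>
  define \<phi> where "\<phi> n x = real n * p x / (1 + real n * p x)" for n x
  have pos: "1 + real n * p x > 0" for n x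
    using p(2)[of x] by (simp add: add_pos_nonneg)
  have "C1 (\<phi> n)" for n
    unfolding \<phi>_def
  proof (rule C1_compose[where h = "\<lambda>t. real n * t / (1 + real n * t)" and h' = "\<lambda>t. real n / (1 + real n * t)\<^sup>2", OF p(1)])
    show "((\<lambda>t. real n * t / (1 + real n * t)) has_real_derivative real n / (1 + real n * t)\<^sup>2) (at t)"
      if "t \<in> range p" for t
    proof -
      have "1 + real n * t \<noteq> 0" using that pos by (metis imageE less_irrefl)
      then show ?thesis
        by (auto intro!: derivative_eq_intros simp: field_simps power2_eq_square)
    qed
    show "continuous_on (range p) (\<lambda>t. real n / (1 + real n * t)\<^sup>2)"
      by (intro continuous_intros) (use pos in \<open>auto, metis less_irrefl\<close>)
  qed
  then obtain G where G: "\<And>n. (\<forall>x. GDERIV (\<phi> n) x :> G n x) \<and> continuous_on UNIV (G n)"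
    unfolding C1_def by metis
  have zero: "\<phi> n x = 0" if "x \<notin> box a b" for n x
    using p(3) that by (auto simp: \<phi>_def)
  \<comment> \<open>The functions vanish off the open box, but their closed supports may reach its
    boundary; hence the assumption that the closed box lies in \<open>S\<close>.\<close>
  have sub: "closure {x. \<phi> n x \<noteq> 0} \<subseteq> cbox a b" for n
    using zero by (intro closure_minimal) (auto simp: closed_cbox intro: box_subset_cbox[THEN subsetD])
  have "test_function S (\<phi> n) (G n)" for n
    unfolding test_function_def
    using G[of n] sub[of n] assms compact_closure[of "{x. \<phi> n x \<noteq> 0}"]
      bounded_subset[OF bounded_cbox[of a b] subset_trans[OF closure_subset sub[of n]]]
    by auto
  moreover have "\<bar>\<phi> n x\<bar> \<le> indicator (cbox a b) x" for n x
  proof (cases "x \<in> box a b")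
    case True
    have "0 \<le> real n * p x" using p(2)[of x] by simp
    then have "\<bar>\<phi> n x\<bar> \<le> 1" unfolding \<phi>_def by (subst abs_of_nonneg) auto
    then show ?thesis using True box_subset_cbox by (auto simp: indicator_def)
  qed (simp add: zero)
  moreover have "(\<lambda>n. \<phi> n x) \<longlonglongrightarrow> indicator (box a b) x" for x
  proof (cases "x \<in> box a b")
    case True
    then have px: "p x > 0" using p(2)[of x] p(3)[of x] by (simp add: order_less_le)
    have "LIM n sequentially. real n * p x :> at_top"
      by (rule filterlim_at_top_mult_tendsto_pos[OF tendsto_const px filterlim_real_sequentially])
    then have "(\<lambda>n. inverse (1 + real n * p x)) \<longlonglongrightarrow> 0"
      by (intro tendsto_inverse_0_at_top filterlim_tendsto_add_at_top[OF tendsto_const])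
    then have "(\<lambda>n. 1 - inverse (1 + real n * p x)) \<longlonglongrightarrow> 1 - 0"
      by (intro tendsto_diff tendsto_const)
    moreover have "1 - inverse (1 + real n * p x) = \<phi> n x" for n
      using pos[of n x] by (simp add: \<phi>_def field_simps)
    ultimately show ?thesis using True by simp
  qed (simp add: zero)
  ultimately show thesis using that by blast
qed

text \<open>By Lebesgue differentiation almost every value of the function is a limit of averages
  over small cubes, and these averages vanish inside \<open>S\<close>.\<close>

lemma AE_zero_if_box_integrals_zero:
  fixes f :: "'a::euclidean_space \<Rightarrow> 'b::euclidean_space"
  assumes "open S" "loc_integrable S f"
    and zero: "\<And>a b. cbox a b \<subseteq> S \<Longrightarrow> integral (cbox a b) f = 0"
  shows "AE x in lebesgue. x \<in> S \<longrightarrow> f x = 0"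
proof -
  have 1: "AE x in lebesgue. x \<in> cbox c d \<longrightarrow> f x = 0" if cd: "cbox c d \<subseteq> S" for c d
  proof -
    \<comment> \<open>Local integrability says nothing up to the boundary of \<open>S\<close>;
      truncation to one closed box gives a globally integrable function to differentiate.\<close>
    define F where "F x = (if x \<in> cbox c d then f x else 0)" for x
    have "f absolutely_integrable_on cbox c d"
      using assms(2) cd unfolding loc_integrable_def by auto
    then have "F absolutely_integrable_on UNIV"
      unfolding F_def by (simp only: absolutely_integrable_restrict_UNIV)
    then have "F integrable_on cbox a b" for a b
      using integrable_on_subcbox set_lebesgue_integral_eq_integral(1) by blast
    then obtain N where N: "negligible N" "\<And>x e. \<lbrakk>x \<notin> N; 0 < e\<rbrakk> \<Longrightarrow>
       \<exists>r>0. \<forall>h. 0 < h \<and> h < r \<longrightarrow>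
         norm (integral (cbox x (x + h *\<^sub>R One)) F /\<^sub>R h ^ DIM('a) - F x) < e"
      using integrable_ccontinuous_explicit[of F] by metis
    have "f x = 0" if x: "x \<in> box c d" "x \<notin> N" for x
    proof (rule ccontr)
      assume "f x \<noteq> 0"
      then have "0 < norm (f x)" by simp
      then obtain r where r: "r > 0" "\<And>h. 0 < h \<Longrightarrow> h < r \<Longrightarrow>
         norm (integral (cbox x (x + h *\<^sub>R One)) F /\<^sub>R h ^ DIM('a) - F x) < norm (f x)"
        using N(2)[OF x(2)] by blast
      \<comment> \<open>The differentiation theorem uses cubes with lower corner \<open>x\<close>.
        Such a cube lies in the box as soon as its upper corner does, which holds for small
        \<open>h\<close>.\<close>
      have "\<forall>\<^sub>F h in at_right 0. x + h *\<^sub>R One \<in> box c d"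
      proof -
        have "((\<lambda>h. x + h *\<^sub>R One) \<longlongrightarrow> x + 0 *\<^sub>R One) (at_right (0::real))"
          by (intro tendsto_intros)
        then show ?thesis using x(1) by (intro topological_tendstoD) auto
      qed
      moreover have "\<forall>\<^sub>F h in at_right 0. 0 < h \<and> h < r"
        using r(1) eventually_at_right_less[of 0] eventually_at_right_field by blast
      ultimately have "\<forall>\<^sub>F h in at_right 0. x + h *\<^sub>R One \<in> box c d \<and> 0 < h \<and> h < r"
        by eventually_elim auto
      then obtain h where h: "x + h *\<^sub>R One \<in> box c d" "0 < h" "h < r"
        using eventually_happens'[OF trivial_limit_at_right_real] by blast
      have sub: "cbox x (x + h *\<^sub>R One) \<subseteq> cbox c d"
        using x(1) h(1) by (intro subset_box_imp(1)) (auto simp: mem_box intro!: less_imp_le)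
      have "integral (cbox x (x + h *\<^sub>R One)) F = integral (cbox x (x + h *\<^sub>R One)) f"
        by (rule integral_cong) (use sub in \<open>auto simp: F_def\<close>)
      also have "\<dots> = 0" using sub cd by (intro zero) auto
      finally have "norm (F x) < norm (f x)" using r(2)[of h] h by simp
      then show False using x(1) box_subset_cbox[of c d] by (auto simp: F_def)
    qed
    then have "{x. \<not> (x \<in> cbox c d \<longrightarrow> f x = 0)} \<subseteq> N \<union> (cbox c d - box c d)" by auto
    moreover have "negligible (N \<union> (cbox c d - box c d))"
      using N(1) negligible_frontier_interval by (rule negligible_Un)
    ultimately show ?thesis
      unfolding negligible_iff_null_sets by (intro AE_I') auto
  qed
  \<comment> \<open>Countably many closed boxes exhaust the open set, so their exceptional null sets
    unite to a null set.\<close>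
  obtain \<D> where D: "countable \<D>" "\<D> \<subseteq> Pow S" "\<And>X. X \<in> \<D> \<Longrightarrow> \<exists>a b. X = cbox a b" "\<Union>\<D> = S"
    by (rule open_countable_Union_open_cbox[OF assms(1)]) (rule that)
  have "AE x in lebesgue. \<forall>X\<in>\<D>. x \<in> X \<longrightarrow> f x = 0"
    unfolding AE_ball_countable[OF D(1)]
  proof
    fix X assume "X \<in> \<D>"
    then obtain c d where "X = cbox c d" "cbox c d \<subseteq> S" using D(2,3) by blast
    then show "AE x in lebesgue. x \<in> X \<longrightarrow> f x = 0" using 1 by simp
  qed
  then show ?thesis
    by (rule AE_mp) (use D(4) in auto)
qed

text \<open>Off the closed support the function is 0 on an open set, so its derivative there is also
  the zero map; uniqueness of derivatives, evaluated in the direction \<open>G x\<close>, kills the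
  gradient.\<close>

lemma test_function_eq_0:
  assumes "test_function S \<phi> G" "x \<notin> closure {x. \<phi> x \<noteq> 0}"
  shows "\<phi> x = 0" "G x = 0"
proof -
  have zero: "\<phi> y = 0" if "y \<in> - closure {x. \<phi> x \<noteq> 0}" for y
  proof (rule ccontr)
    assume "\<phi> y \<noteq> 0"
    then have "y \<in> closure {x. \<phi> x \<noteq> 0}" by (intro subsetD[OF closure_subset] CollectI)
    with ComplD[OF that] show False by (rule notE)
  qed
  have x: "x \<in> - closure {x. \<phi> x \<noteq> 0}" using assms(2) unfolding Compl_iff .
  then show "\<phi> x = 0" by (rule zero)
  have *: "(\<phi> has_derivative (\<lambda>h. h \<bullet> G x)) (at x)"
    using assms(1) unfolding test_function_def gderiv_def by (elim conjE allE)
  have "((\<lambda>x. 0) has_derivative (\<lambda>h. h \<bullet> G x)) (at x)"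
    by (rule has_derivative_transform_within_open[OF *, of "- closure {x. \<phi> x \<noteq> 0}"])
       (rule open_Compl[OF closed_closure], rule x, rule zero, assumption)
  then have "(\<lambda>h. h \<bullet> G x) = (\<lambda>h. 0)"
    by (rule has_derivative_unique[OF _ has_derivative_const])
  from fun_cong[OF this, of "G x"] have "G x \<bullet> G x = 0" .
  then show "G x = 0" by simp
qed

text \<open>On the compact set \<open>C\<close> the factor \<open>h\<close> is bounded and
  \<open>f\<close> is integrable; off \<open>C\<close> the product is 0. A general bilinear
  \<open>B\<close> covers both products in the definition of a weak gradient, where the scalar and
  the vector factor exchange roles.\<close>

lemma loc_integrable_cutoff:
  fixes h :: "'a::euclidean_space \<Rightarrow> 'b::euclidean_space"
    and f :: "'a \<Rightarrow> 'c::euclidean_space"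
    and B :: "'b \<Rightarrow> 'c \<Rightarrow> 'd::euclidean_space"
  assumes "loc_integrable S f" "compact C" "C \<subseteq> S" "continuous_on UNIV h"
    and zero: "\<And>x. x \<notin> C \<Longrightarrow> h x = 0" and B: "bounded_bilinear B"
  shows "set_integrable lebesgue S (\<lambda>x. B (h x) (f x))"
proof -
  interpret bounded_bilinear B by fact
  have f: "set_integrable lebesgue C f"
    using assms unfolding loc_integrable_def by blast
  have C: "C \<in> sets lebesgue" using assms(2) by (simp add: compact_imp_closed borel_closed)
  have h: "h \<in> borel_measurable (lebesgue_on C)"
    using continuous_imp_measurable_on_sets_lebesgue[OF continuous_on_subset[OF assms(4)] C] by simp
  have bdd: "bounded (h ` C)"
    using compact_imp_bounded[OF compact_continuous_image[OF continuous_on_subset[OF assms(4)] assms(2)]]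
    by simp
  have "bilinear B"
    using B by (simp only: bilinear_conv_bounded_bilinear)
  then have "set_integrable lebesgue C (\<lambda>x. B (h x) (f x))"
    by (rule absolutely_integrable_bounded_measurable_product[OF _ h C bdd f])
  moreover have "indicator C x *\<^sub>R B (h x) (f x) = indicator S x *\<^sub>R B (h x) (f x)" for x
    using zero[of x] assms(3) zero_left by (cases "x \<in> C") (auto simp: indicator_def)
  ultimately show ?thesis unfolding set_integrable_def by simp
qed

text \<open>Both integrals in the defining identity of a weak gradient truly exist, rather than
  being default values, and can therefore be split linearly.\<close>

lemma set_integrable_test_function:
  assumes "test_function S \<phi> G" "loc_integrable S u" "loc_integrable S g"
  shows "set_integrable lebesgue S (\<lambda>x. u x *\<^sub>R G x)" "set_integrable lebesgue S (\<lambda>x. \<phi> x *\<^sub>R g x)"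
proof -
  let ?C = "closure {x. \<phi> x \<noteq> 0}"
  have C: "compact ?C" "?C \<subseteq> S" "continuous_on UNIV G" "\<forall>x. GDERIV \<phi> x :> G x"
    using assms(1) unfolding test_function_def by simp_all
  show "set_integrable lebesgue S (\<lambda>x. u x *\<^sub>R G x)"
    by (rule loc_integrable_cutoff[where B = "\<lambda>y r. r *\<^sub>R y" and h = G and f = u,
          OF assms(2) C(1,2,3)])
       (simp_all only: test_function_eq_0(2)[OF assms(1)]
          bounded_bilinear.flip[OF bounded_bilinear_scaleR] not_False_eq_True)
  show "set_integrable lebesgue S (\<lambda>x. \<phi> x *\<^sub>R g x)"
    by (rule loc_integrable_cutoff[where B = "\<lambda>r y. r *\<^sub>R y" and h = \<phi> and f = g,
          OF assms(3) C(1,2) GDERIV_continuous[OF C(4)]])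
       (simp_all only: test_function_eq_0(1)[OF assms(1)] bounded_bilinear_scaleR not_False_eq_True)
qed

lemma has_weak_gradient_lincomb:
  fixes u v :: "'a::euclidean_space \<Rightarrow> real"
  assumes "has_weak_gradient S u g" "has_weak_gradient S v h"
  shows "has_weak_gradient S (\<lambda>x. r * u x + s * v x) (\<lambda>x. r *\<^sub>R g x + s *\<^sub>R h x)"
proof -
  have L: "loc_integrable S u" "loc_integrable S g" "loc_integrable S v" "loc_integrable S h"
    using assms unfolding has_weak_gradient_def by auto
  have "(LINT x:S|lebesgue. (r * u x + s * v x) *\<^sub>R G x) =
      - (LINT x:S|lebesgue. \<phi> x *\<^sub>R (r *\<^sub>R g x + s *\<^sub>R h x))"
    if t: "test_function S \<phi> G" for \<phi> G
  proof -
    note i = set_integrable_test_function[OF t L(1,2)] set_integrable_test_function[OF t L(3,4)]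
    have "(LINT x:S|lebesgue. (r * u x + s * v x) *\<^sub>R G x)
        = (LINT x:S|lebesgue. r *\<^sub>R (u x *\<^sub>R G x) + s *\<^sub>R (v x *\<^sub>R G x))"
      by (simp add: scaleR_add_left)
    also have "\<dots> = r *\<^sub>R (LINT x:S|lebesgue. u x *\<^sub>R G x) + s *\<^sub>R (LINT x:S|lebesgue. v x *\<^sub>R G x)"
      using i by (subst set_integral_add) (auto simp del: scaleR_scaleR)
    also have "\<dots> = - (r *\<^sub>R (LINT x:S|lebesgue. \<phi> x *\<^sub>R g x) + s *\<^sub>R (LINT x:S|lebesgue. \<phi> x *\<^sub>R h x))"
      using assms t unfolding has_weak_gradient_def by simp
    also have "\<dots> = - (LINT x:S|lebesgue. r *\<^sub>R (\<phi> x *\<^sub>R g x) + s *\<^sub>R (\<phi> x *\<^sub>R h x))"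
      using i by (subst set_integral_add) (auto simp del: scaleR_scaleR)
    finally show ?thesis by (simp add: scaleR_add_right mult.commute)
  qed
  then show ?thesis
    using L unfolding has_weak_gradient_def loc_integrable_def by auto
qed

text \<open>The difference of two weak gradients is a weak gradient of the zero function, hence
  orthogonal to every test function. Letting test functions tend to the indicator of a box gives
  zero integral over that box.\<close>

lemma has_weak_gradient_unique:
  fixes u :: "'a::euclidean_space \<Rightarrow> real"
  assumes S: "open S" and "has_weak_gradient S u g" "has_weak_gradient S u h"
  shows "AE x in lebesgue. x \<in> S \<longrightarrow> g x = h x"
proof -
  have "has_weak_gradient S (\<lambda>x. 1 * u x + (-1) * u x) (\<lambda>x. 1 *\<^sub>R g x + (-1) *\<^sub>R h x)"
    by (rule has_weak_gradient_lincomb) fact+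
  then have *: "has_weak_gradient S (\<lambda>x. 0) (\<lambda>x. g x - h x)" (is "has_weak_gradient S _ ?f") by simp
  then have loc: "loc_integrable S ?f" unfolding has_weak_gradient_def by simp
  have "AE x in lebesgue. x \<in> S \<longrightarrow> ?f x = 0"
  proof (rule AE_zero_if_box_integrals_zero[OF S loc])
    fix a b assume ab: "cbox a b \<subseteq> S"
    obtain \<phi> G where t: "\<And>n::nat. test_function S (\<phi> n) (G n)"
      "\<And>n x. \<bar>\<phi> n x\<bar> \<le> indicator (cbox a b) x"
      "\<And>x. (\<lambda>n. \<phi> n x) \<longlonglongrightarrow> indicator (box a b) x"
      by (rule test_functions_tendsto_box[OF ab]) (rule that)
    have int: "set_integrable lebesgue (cbox a b) ?f"
      using loc ab unfolding loc_integrable_def by auto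
    have intS: "set_integrable lebesgue S (\<lambda>x. \<phi> n x *\<^sub>R ?f x)" for n
      by (rule set_integrable_test_function(2)[OF t(1) _ loc, of "\<lambda>_. 0"])
         (simp add: loc_integrable_def set_integrable_def)
    \<comment> \<open>Dominated convergence, with the norm of the integrand on the closed box as
      majorant.\<close>
    have "(\<lambda>n. LINT x:S|lebesgue. \<phi> n x *\<^sub>R ?f x) \<longlonglongrightarrow> (LINT x:box a b|lebesgue. ?f x)"
      unfolding set_lebesgue_integral_def
    proof (rule integral_dominated_convergence[where w = "\<lambda>x. norm (indicator (cbox a b) x *\<^sub>R ?f x)"])
      show "(\<lambda>x. indicator (box a b) x *\<^sub>R ?f x) \<in> borel_measurable lebesgue"
        using set_integrable_subset[OF int, of "box a b"] box_subset_cbox[of a b]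
        unfolding set_integrable_def by auto
      show "(\<lambda>x. indicator S x *\<^sub>R \<phi> n x *\<^sub>R ?f x) \<in> borel_measurable lebesgue" for n
        using intS unfolding set_integrable_def by auto
      show "integrable lebesgue (\<lambda>x. norm (indicator (cbox a b) x *\<^sub>R ?f x))"
        using int unfolding set_integrable_def by (rule integrable_norm)
      show "AE x in lebesgue. (\<lambda>n. indicator S x *\<^sub>R \<phi> n x *\<^sub>R ?f x) \<longlonglongrightarrow> indicator (box a b) x *\<^sub>R ?f x"
      proof (rule AE_I2)
        fix x
        have "(\<lambda>n. indicator S x *\<^sub>R \<phi> n x *\<^sub>R ?f x) \<longlonglongrightarrow> indicator S x *\<^sub>R indicator (box a b) x *\<^sub>R ?f x"
          by (intro tendsto_intros t(3))
        then show "(\<lambda>n. indicator S x *\<^sub>R \<phi> n x *\<^sub>R ?f x) \<longlonglongrightarrow> indicator (box a b) x *\<^sub>R ?f x"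
          using ab box_subset_cbox[of a b] by (cases "x \<in> box a b") (auto simp: indicator_def split: if_splits)
      qed
      show "AE x in lebesgue. norm (indicator S x *\<^sub>R \<phi> n x *\<^sub>R ?f x) \<le> norm (indicator (cbox a b) x *\<^sub>R ?f x)" for n
      proof (rule AE_I2)
        fix x
        have "\<bar>indicator S x * \<phi> n x\<bar> \<le> indicator (cbox a b) x"
          using t(2)[of n x] by (auto simp: indicator_def split: if_splits)
        then have "\<bar>indicator S x * \<phi> n x\<bar> * norm (?f x) \<le> indicator (cbox a b) x * norm (?f x)"
          by (rule mult_right_mono) simp
        then show "norm (indicator S x *\<^sub>R \<phi> n x *\<^sub>R ?f x) \<le> norm (indicator (cbox a b) x *\<^sub>R ?f x)"
          by (simp add: abs_mult)
      qed
    qed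
    \<comment> \<open>The other side of the weak gradient identity is an integral of the zero
      function.\<close>
    moreover have "(LINT x:S|lebesgue. \<phi> n x *\<^sub>R ?f x) = 0" for n
      using * t(1)[of n] unfolding has_weak_gradient_def by fastforce
    ultimately have "(LINT x:box a b|lebesgue. ?f x) = 0"
      by (simp add: LIMSEQ_const_iff)
    moreover have "set_integrable lebesgue (box a b) ?f"
      using set_integrable_subset[OF int, of "box a b"] box_subset_cbox[of a b] by auto
    ultimately have "integral (box a b) ?f = 0"
      by (simp add: set_lebesgue_integral_eq_integral(2))
    then show "integral (cbox a b) ?f = 0"
      by (simp add: integral_open_interval)
  qed
  then show ?thesis by simp
qed

section \<open>Weak gradients modulo null sets, and the chosen representative\<close>

lemma loc_integrable_cong_AE:
  fixes f g :: "'a::euclidean_space \<Rightarrow> 'b::euclidean_space"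
  assumes "AE x in lebesgue. x \<in> S \<longrightarrow> f x = g x" "loc_integrable S f"
  shows "loc_integrable S g"
  unfolding loc_integrable_def
proof (intro allI impI)
  fix C assume C: "compact C \<and> C \<subseteq> S"
  then have f: "integrable lebesgue (\<lambda>x. indicator C x *\<^sub>R f x)"
    using assms(2) unfolding loc_integrable_def set_integrable_def by blast
  have eq: "AE x in lebesgue. indicator C x *\<^sub>R f x = indicator C x *\<^sub>R g x"
    using assms(1) by eventually_elim (use C in \<open>auto simp: indicator_def\<close>)
  have "(\<lambda>x. indicator C x *\<^sub>R g x) \<in> borel_measurable lebesgue"
    by (rule borel_measurable_AE[OF borel_measurable_integrable[OF f] eq])
  then show "set_integrable lebesgue C g"
    unfolding set_integrable_def
    by (rule integrable_cong_AE[THEN iffD1, OF borel_measurable_integrable[OF f] _ eq f])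
qed

text \<open>The identity sees a function only through integrals. This invariance matters because
  \<open>T1\<close> respects linear combinations only almost everywhere.\<close>

lemma has_weak_gradient_cong_AE:
  fixes u v :: "'a::euclidean_space \<Rightarrow> real"
  assumes "AE x in lebesgue. x \<in> S \<longrightarrow> u x = v x"
  shows "has_weak_gradient S u = has_weak_gradient S v"
proof -
  have *: "has_weak_gradient S v g"
    if uv: "AE x in lebesgue. x \<in> S \<longrightarrow> u x = v x" and u: "has_weak_gradient S u g"
    for u v :: "'a \<Rightarrow> real" and g
  proof -
    have "(LINT x:S|lebesgue. u x *\<^sub>R G x) = (LINT x:S|lebesgue. v x *\<^sub>R G x)"
      if t: "test_function S \<phi> G" for \<phi> and G :: "'a \<Rightarrow> 'a"
      unfolding set_lebesgue_integral_def
    proof (rule integral_cong_AE)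
      have "loc_integrable S u"
        using u unfolding has_weak_gradient_def by blast
      \<comment> \<open>Quantifying over \<open>w\<close> settles measurability for \<open>u\<close>
        and \<open>v\<close> at once.\<close>
      then have "loc_integrable S w" if "w = u \<or> w = v" for w
        using that loc_integrable_cong_AE[OF uv] by blast
      then have "(\<lambda>x. indicator S x *\<^sub>R w x *\<^sub>R G x) \<in> borel_measurable lebesgue" if "w = u \<or> w = v" for w
        using set_integrable_test_function(1)[OF t, of w w] that
        unfolding set_integrable_def by (simp add: borel_measurable_integrable del: scaleR_scaleR)
      then show "(\<lambda>x. indicator S x *\<^sub>R u x *\<^sub>R G x) \<in> borel_measurable lebesgue"
        "(\<lambda>x. indicator S x *\<^sub>R v x *\<^sub>R G x) \<in> borel_measurable lebesgue"
        by blast+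
      show "AE x in lebesgue. indicator S x *\<^sub>R u x *\<^sub>R G x = indicator S x *\<^sub>R v x *\<^sub>R G x"
        using uv by eventually_elim (auto simp: indicator_def)
    qed
    then show ?thesis
      using u loc_integrable_cong_AE[OF uv] unfolding has_weak_gradient_def by simp
  qed
  have "AE x in lebesgue. x \<in> S \<longrightarrow> v x = u x"
    using assms by eventually_elim auto
  then show ?thesis by (intro ext iffI) (rule *[OF assms], assumption, rule *)
qed

lemma has_weak_gradient_weak_gradient:
  "has_weak_gradient S u g \<Longrightarrow> has_weak_gradient S u (weak_gradient S u)"
  unfolding weak_gradient_def by (rule someI[of "has_weak_gradient S u"])

text \<open>Membership in \<open>H1\<close> provides some square integrable weak gradient, while the
  choice operator may return another; uniqueness transfers square integrability to the chosen
  one.\<close>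

lemma H1_weak_gradient:
  fixes S :: "'a::euclidean_space set"
  assumes "open S" "u \<in> H1 S"
  shows "has_weak_gradient S u (weak_gradient S u)" "sq_integrable S (weak_gradient S u)"
proof -
  obtain g where g: "has_weak_gradient S u g" "sq_integrable S g"
    using assms(2) unfolding H1_def by blast
  show wg: "has_weak_gradient S u (weak_gradient S u)"
    by (rule has_weak_gradient_weak_gradient[OF g(1)])
  show "sq_integrable S (weak_gradient S u)"
    by (rule sq_integrable_cong_AE[OF has_weak_gradient_unique[OF assms(1) g(1) wg] g(2)])
qed

lemma weak_gradient_lincomb_AE:
  fixes u v :: "'a::euclidean_space \<Rightarrow> real"
  assumes S: "open S" and u: "u \<in> H1 S" and v: "v \<in> H1 S"
    and w: "AE x in lebesgue. x \<in> S \<longrightarrow> w x = r * u x + s * v x"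
  shows "AE x in lebesgue. x \<in> S \<longrightarrow>
    weak_gradient S w x = r *\<^sub>R weak_gradient S u x + s *\<^sub>R weak_gradient S v x"
proof -
  have "has_weak_gradient S (\<lambda>x. r * u x + s * v x)
      (\<lambda>x. r *\<^sub>R weak_gradient S u x + s *\<^sub>R weak_gradient S v x)" (is "has_weak_gradient S _ ?g")
    by (intro has_weak_gradient_lincomb H1_weak_gradient S u v)
  then have "has_weak_gradient S w ?g"
    using has_weak_gradient_cong_AE[OF w] by simp
  then show ?thesis
    using has_weak_gradient_unique[OF S has_weak_gradient_weak_gradient] by blast
qed

section \<open>The inner product and the energy\<close>

lemma energy_commute: "energy M u v = energy M v u"
  unfolding energy_def energy_on_def by (simp add: inner_commute)

definition piecewise_H1 :: "('d::finite) multicontinuum \<Rightarrow> (real^'d \<Rightarrow> real) \<Rightarrow> bool" where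
  "piecewise_H1 M u \<longleftrightarrow> (\<forall>l\<in>centers M. u \<in> H1 (interior (block M l)))"

lemma L2_inner_commute: "L2_inner M u v = L2_inner M v u"
  unfolding L2_inner_def by (simp add: mult.commute)

lemma L2_inner_nonneg: "L2_inner M u u \<ge> 0"
  unfolding L2_inner_def set_lebesgue_integral_def by (intro integral_nonneg_AE AE_I2) auto

lemma T0_lincomb:
  "T0 M j (\<lambda>k x. r * U k x + s * W k x) x = r * T0 M j U x + s * T0 M j W x"
  unfolding T0_def by (simp add: sum_distrib_left sum.distrib[symmetric] algebra_simps)

lemma L2_norm_power2: "(L2_norm M u)\<^sup>2 = L2_inner M u u"
  unfolding L2_norm_def using L2_inner_nonneg by simp

context
  fixes M :: "('d::finite) multicontinuum"
  assumes setting: "multicontinuum_setting M"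
begin

section \<open>Mesh geometry, and bilinearity of the energy and the inner product\<close>

lemma open_omega: "open (omega M)"
  using setting unfolding multicontinuum_setting_def polygonal_domain_def by (metis open_interior)

text \<open>Blocks cover the closure of the domain, whose interior could in general be larger than
  the domain, as for a slit disc. A polygonal domain is the interior of a closed set, which rules
  this out.\<close>

lemma interior_block_subset:
  assumes "l \<in> centers M"
  shows "interior (block M l) \<subseteq> omega M"
proof -
  have "polygonal_domain (omega M)" and mesh: "coarse_mesh (omega M) (centers M) (block M)"
    using setting unfolding multicontinuum_setting_def by auto
  then obtain P where P: "finite P" "\<And>p. p \<in> P \<Longrightarrow> polytope p" "omega M = interior (\<Union>P)"
    unfolding polygonal_domain_def by blast
  have "closed (\<Union>P)" using P(1,2) by (intro closed_Union) (auto intro: polytope_imp_closed)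
  then have "closure (omega M) \<subseteq> \<Union>P" using P(3) interior_subset by (metis closure_minimal)
  moreover have "block M l \<subseteq> closure (omega M)" using mesh assms unfolding coarse_mesh_def by auto
  ultimately show ?thesis unfolding P(3) by (intro interior_mono) auto
qed

text \<open>The frontier of a convex set is null. This reconciles energies integrated over closed
  blocks with weak gradients taken on their interiors.\<close>

lemma AE_block_interior:
  assumes "l \<in> centers M"
  shows "AE x in lebesgue. x \<in> block M l \<longleftrightarrow> x \<in> interior (block M l)"
proof -
  have "polytope (block M l)"
    using setting assms unfolding multicontinuum_setting_def coarse_mesh_def by blast
  then have "negligible (frontier (block M l))"
    by (intro negligible_convex_frontier polytope_imp_convex)
  moreover have "{x. \<not> (x \<in> block M l \<longleftrightarrow> x \<in> interior (block M l))} \<subseteq> frontier (block M l)"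
    using interior_subset closure_subset by (fastforce simp: frontier_def)
  ultimately show ?thesis
    unfolding negligible_iff_null_sets by (intro AE_I') auto
qed

lemma coeff_block:
  assumes "l \<in> centers M"
  shows "set_borel_measurable lebesgue (interior (block M l)) (coeff M)"
    and "\<exists>k. \<forall>x\<in>interior (block M l). 0 \<le> coeff M x \<and> \<bar>coeff M x\<bar> \<le> k"
proof -
  have c: "set_borel_measurable lebesgue (omega M) (coeff M)"
    and "\<exists>k0>0. \<exists>k1. \<forall>x\<in>omega M. k0 \<le> coeff M x \<and> coeff M x \<le> k1"
    using setting unfolding multicontinuum_setting_def by auto
  then obtain k0 k1 where k: "k0 > 0" "\<And>x. x \<in> omega M \<Longrightarrow> k0 \<le> coeff M x \<and> coeff M x \<le> k1" by blast
  show "set_borel_measurable lebesgue (interior (block M l)) (coeff M)"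
    by (rule set_borel_measurable_subset[OF c _ interior_block_subset[OF assms]]) simp
  show "\<exists>k. \<forall>x\<in>interior (block M l). 0 \<le> coeff M x \<and> \<bar>coeff M x\<bar> \<le> k"
    using k interior_block_subset[OF assms] by (intro exI[of _ k1]) (fastforce)
qed

lemma energy_on_interior:
  assumes "l \<in> centers M"
  shows "energy_on M (block M l) u v = (LINT x:interior (block M l)|lebesgue.
    coeff M x * (weak_gradient (interior (block M l)) u x \<bullet> weak_gradient (interior (block M l)) v x))"
  unfolding energy_on_def by (rule set_lebesgue_integral_cong_set_AE[OF AE_block_interior[OF assms]])

lemma energy_on_lincomb:
  assumes l: "l \<in> centers M"
    and H1: "u \<in> H1 (interior (block M l))" "v \<in> H1 (interior (block M l))" "w \<in> H1 (interior (block M l))"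
    and z: "AE x in lebesgue. x \<in> interior (block M l) \<longrightarrow> z x = r * u x + s * v x"
  shows "energy_on M (block M l) z w = r * energy_on M (block M l) u w + s * energy_on M (block M l) v w"
proof -
  let ?S = "interior (block M l)"
  let ?w = "weak_gradient ?S"
  obtain k where k: "\<And>x. x \<in> ?S \<Longrightarrow> \<bar>coeff M x\<bar> \<le> k" using coeff_block(2)[OF l] by blast
  have int: "set_integrable lebesgue ?S (\<lambda>x. coeff M x * (?w u x \<bullet> ?w w x))"
    if "u \<in> H1 ?S" for u
    by (intro set_integrable_weighted_inner[OF _ _ coeff_block(1)[OF l] k] H1_weak_gradient(2) that H1 open_interior)
  have "energy_on M (block M l) z w = (LINT x:?S|lebesgue.
      r * (coeff M x * (?w u x \<bullet> ?w w x)) + s * (coeff M x * (?w v x \<bullet> ?w w x)))"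
    unfolding energy_on_interior[OF l]
    by (rule set_lebesgue_integral_cong_AE_lebesgue,
        rule AE_mp[OF weak_gradient_lincomb_AE[OF open_interior H1(1,2) z]])
       (auto simp: inner_add_left algebra_simps)
  also have "\<dots> = r * energy_on M (block M l) u w + s * energy_on M (block M l) v w"
    unfolding energy_on_interior[OF l] using int[OF H1(1)] int[OF H1(2)]
    by (subst set_integral_add) auto
  finally show ?thesis .
qed

lemma energy_nonneg: "energy M u u \<ge> 0"
  unfolding energy_def
proof (rule sum_nonneg)
  fix l assume l: "l \<in> centers M"
  show "energy_on M (block M l) u u \<ge> 0"
    unfolding energy_on_interior[OF l] set_lebesgue_integral_def
    using coeff_block(2)[OF l] by (intro integral_nonneg_AE AE_I2) (auto simp: indicator_def)
qed

lemma energy_lincomb: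
  assumes "piecewise_H1 M u" "piecewise_H1 M v" "piecewise_H1 M w"
    and z: "AE x in lebesgue. x \<in> omega M \<longrightarrow> z x = r * u x + s * v x"
  shows "energy M z w = r * energy M u w + s * energy M v w"
proof -
  have "energy_on M (block M l) z w = r * energy_on M (block M l) u w + s * energy_on M (block M l) v w"
    if l: "l \<in> centers M" for l
  proof (rule energy_on_lincomb[OF l])
    show "AE x in lebesgue. x \<in> interior (block M l) \<longrightarrow> z x = r * u x + s * v x"
      by (rule AE_mp[OF z]) (use interior_block_subset[OF l] in auto)
  qed (use assms(1-3) l in \<open>auto simp: piecewise_H1_def\<close>)
  then show ?thesis unfolding energy_def by (simp add: sum.distrib sum_distrib_left)
qed

lemma L2_inner_lincomb:
  assumes "sq_integrable (omega M) u" "sq_integrable (omega M) v" "sq_integrable (omega M) w"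
    and z: "AE x in lebesgue. x \<in> omega M \<longrightarrow> z x = r * u x + s * v x"
  shows "L2_inner M z w = r * L2_inner M u w + s * L2_inner M v w"
proof -
  have S: "omega M \<in> sets lebesgue" using open_omega by auto
  have "L2_inner M z w = (LINT x:omega M|lebesgue. r * (u x * w x) + s * (v x * w x))"
    unfolding L2_inner_def
    by (rule set_lebesgue_integral_cong_AE_lebesgue, rule AE_mp[OF z]) (auto simp: algebra_simps)
  also have "\<dots> = r * L2_inner M u w + s * L2_inner M v w"
    unfolding L2_inner_def using set_integrable_mult_sq[OF S assms(1,3)] set_integrable_mult_sq[OF S assms(2,3)]
    by (subst set_integral_add) auto
  finally show ?thesis .
qed

text \<open>The integral of the square of \<open>r * u x + s * v x\<close> is a nonnegative
  quadratic form in \<open>r\<close> and \<open>s\<close>; its discriminant gives the bound.\<close>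

lemma L2_inner_Cauchy_Schwarz:
  assumes u: "sq_integrable (omega M) u" and v: "sq_integrable (omega M) v"
  shows "\<bar>L2_inner M u v\<bar> \<le> L2_norm M u * L2_norm M v"
proof -
  have S: "omega M \<in> sets lebesgue" using open_omega by auto
  note int = set_integrable_mult_sq[OF S u u] set_integrable_mult_sq[OF S u v] set_integrable_mult_sq[OF S v v]
  have "0 \<le> r\<^sup>2 * L2_inner M u u + 2 * r * s * L2_inner M u v + s\<^sup>2 * L2_inner M v v" for r s
  proof -
    have "0 \<le> (LINT x:omega M|lebesgue. (r * u x + s * v x)\<^sup>2)"
      unfolding set_lebesgue_integral_def by (intro integral_nonneg_AE AE_I2) auto
    also have "\<dots> = (LINT x:omega M|lebesgue.
        (r\<^sup>2 * (u x * u x) + (2 * r * s) * (u x * v x)) + s\<^sup>2 * (v x * v x))"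
      by (rule set_lebesgue_integral_cong[OF S]) (simp add: power2_eq_square algebra_simps)
    also have "\<dots> = r\<^sup>2 * L2_inner M u u + 2 * r * s * L2_inner M u v + s\<^sup>2 * L2_inner M v v"
      unfolding L2_inner_def using int
      by (subst set_integral_add(2), auto)+
    finally show ?thesis .
  qed
  then have "(L2_inner M u v)\<^sup>2 \<le> L2_inner M u u * L2_inner M v v"
    by (rule quadratic_discriminant_le)
  then show ?thesis
    by (simp add: L2_norm_def real_sqrt_mult[symmetric] real_le_rsqrt)
qed

end

section \<open>The abstract energy estimate\<close>

text \<open>These are the common properties of the mass form and of the summed energy form. The
  index order follows m_ij: the first argument lies in \<open>V j\<close> and the second in
  \<open>V i\<close>. Linearity in the second argument follows from \<open>commute\<close>.\<close>

locale psd_forms =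
  fixes V :: "nat \<Rightarrow> ('k \<Rightarrow> 'a \<Rightarrow> real) set"
    and F :: "nat \<Rightarrow> nat \<Rightarrow> ('k \<Rightarrow> 'a \<Rightarrow> real) \<Rightarrow> ('k \<Rightarrow> 'a \<Rightarrow> real) \<Rightarrow> real"
  assumes subspace: "j \<in> {1, 2} \<Longrightarrow> vector_fun.subspace (V j)"
    and lincomb_left: "\<lbrakk>i \<in> {1, 2}; j \<in> {1, 2}; U \<in> V j; U' \<in> V j; W \<in> V i\<rbrakk> \<Longrightarrow>
      F i j (\<lambda>k x. r * U k x + s * U' k x) W = r * F i j U W + s * F i j U' W"
    and commute: "\<lbrakk>i \<in> {1, 2}; j \<in> {1, 2}; U \<in> V j; W \<in> V i\<rbrakk> \<Longrightarrow> F i j U W = F j i W U"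
    and nonneg: "\<lbrakk>i \<in> {1, 2}; W \<in> V i\<rbrakk> \<Longrightarrow> F i i W W \<ge> 0"
begin

lemma diff_mem: "\<lbrakk>j \<in> {1, 2}; U \<in> V j; U' \<in> V j\<rbrakk> \<Longrightarrow> U - U' \<in> V j"
  using vector_fun.subspace_diff[OF subspace] by blast

lemma diff_left:
  assumes "i \<in> {1, 2}" "j \<in> {1, 2}" "U \<in> V j" "U' \<in> V j" "W \<in> V i"
  shows "F i j (U - U') W = F i j U W - F i j U' W"
  using lincomb_left[OF assms, of 1 "-1"] by (simp add: fun_diff_def)

lemma diff_right:
  assumes "i \<in> {1, 2}" "j \<in> {1, 2}" "U \<in> V i" "U' \<in> V i" "W \<in> V j"
  shows "F i j W (U - U') = F i j W U - F i j W U'"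
  using diff_left[OF assms(2,1,3-5)] commute[OF assms(1,2,5)] diff_mem[OF assms(1,3,4)] assms(3,4)
  by simp

lemma diff_quot_left:
  assumes "i \<in> {1, 2}" "j \<in> {1, 2}" "U \<in> V j" "U' \<in> V j" "W \<in> V i"
  shows "F i j (diff_quot \<tau> U U') W = F i j (U - U') W / \<tau>"
proof -
  have "diff_quot \<tau> U U' = (\<lambda>k x. (1 / \<tau>) * U k x + (- 1 / \<tau>) * U' k x)"
    by (simp add: diff_quot_def diff_divide_distrib)
  then show ?thesis
    using lincomb_left[OF assms, of "1 / \<tau>" "- 1 / \<tau>"] diff_left[OF assms]
    by (simp add: diff_divide_distrib)
qed

end

text \<open>Here \<open>g\<close> stands for gamma squared and \<open>A\<close> for the sum of the
  forms a and c. The two Young hypotheses differ in the place of \<open>g\<close>: each is applied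
  so that \<open>g\<close> falls on the increment of the previous step and weight 1 on the current
  one.\<close>

lemma energy_step:
  fixes V :: "nat \<Rightarrow> ('k \<Rightarrow> 'a \<Rightarrow> real) set" and m A and U :: "nat \<Rightarrow> nat \<Rightarrow> 'k \<Rightarrow> 'a \<Rightarrow> real"
  assumes "psd_forms V m" and "psd_forms V A" and \<tau>: "\<tau> > 0" and g: "g \<le> 1"
    and U: "\<And>j n. j \<in> {1, 2} \<Longrightarrow> U j n \<in> V j"
    and young: "\<And>W1 W2. W1 \<in> V 1 \<Longrightarrow> W2 \<in> V 2 \<Longrightarrow>
        2 * \<bar>m 1 2 W2 W1\<bar> \<le> g * m 2 2 W2 W2 + m 1 1 W1 W1"
      "\<And>W1 W2. W1 \<in> V 1 \<Longrightarrow> W2 \<in> V 2 \<Longrightarrow>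
        2 * \<bar>m 1 2 W2 W1\<bar> \<le> m 2 2 W2 W2 + g * m 1 1 W1 W1"
    and scheme1: "\<And>W. W \<in> V 1 \<Longrightarrow>
        m 1 1 (diff_quot \<tau> (U 1 (n + 1)) (U 1 n)) W + m 1 2 (diff_quot \<tau> (U 2 n) (U 2 (n - 1))) W
        + A 1 1 (U 1 (n + 1)) W + A 1 2 (U 2 n) W = 0"
    and scheme2: "\<And>W. W \<in> V 2 \<Longrightarrow>
        m 2 2 (diff_quot \<tau> (U 2 (n + 1)) (U 2 n)) W + m 2 1 (diff_quot \<tau> (U 1 n) (U 1 (n - 1))) W
        + A 2 1 (U 1 (n + 1)) W + A 2 2 (U 2 n) W = 0"
    and cfl: "\<And>W. W \<in> V 2 \<Longrightarrow> \<tau> * A 2 2 W W \<le> (1 - g) * m 2 2 W W"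
  shows "g / \<tau> * (\<Sum>i\<in>{1,2}. m i i (U i (n + 1) - U i n) (U i (n + 1) - U i n))
      + (\<Sum>i\<in>{1,2}. \<Sum>j\<in>{1,2}. A i j (U j (n + 1)) (U i (n + 1)))
    \<le> g / \<tau> * (\<Sum>i\<in>{1,2}. m i i (U i n - U i (n - 1)) (U i n - U i (n - 1)))
      + (\<Sum>i\<in>{1,2}. \<Sum>j\<in>{1,2}. A i j (U j n) (U i n))"
proof -
  interpret m: psd_forms V m by fact
  interpret A: psd_forms V A by fact
  note One_nat_def [simp del]
  define p q where "p = U 1 (n + 1)" and "q = U 2 (n + 1)"
  define r s where "r = U 1 n" and "s = U 2 n"
  define r' s' where "r' = U 1 (n - 1)" and "s' = U 2 (n - 1)"
  have mem [simp]: "p \<in> V 1" "q \<in> V 2" "r \<in> V 1" "s \<in> V 2" "r' \<in> V 1" "s' \<in> V 2"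
    unfolding p_def q_def r_def s_def r'_def s'_def by (auto intro: U)
  have mem_diff [simp]: "p - r \<in> V 1" "q - s \<in> V 2" "r - r' \<in> V 1" "s - s' \<in> V 2"
    by (intro m.diff_mem mem; simp)+
  have 1: "m 1 1 (p - r) (p - r) / \<tau> + m 1 2 (s - s') (p - r) / \<tau>
      + (A 1 1 p p - A 1 1 p r) + (A 1 2 s p - A 1 2 s r) = 0"
    using scheme1[OF mem_diff(1)] unfolding p_def[symmetric] r_def[symmetric] s_def[symmetric] s'_def[symmetric]
    by (simp add: m.diff_quot_left A.diff_right)
  \<comment> \<open>Mixed terms are flipped into the index pair 1, 2. The first equation uses the
    old second component and the second equation the new first one, so \<open>A 1 2 s p\<close>
    cancels in the sum and the mixed energy telescopes to
    \<open>A 1 2 q p - A 1 2 s r\<close>.\<close>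
  have 2: "m 2 2 (q - s) (q - s) / \<tau> + m 1 2 (q - s) (r - r') / \<tau>
      + (A 1 2 q p - A 1 2 s p) + (A 2 2 s q - A 2 2 s s) = 0"
    using scheme2[OF mem_diff(2)]
    unfolding p_def[symmetric] q_def[symmetric] r_def[symmetric] s_def[symmetric] r'_def[symmetric]
    by (simp add: m.diff_quot_left A.diff_right m.commute[of 2 1] A.commute[of 2 1])
  \<comment> \<open>The implicit treatment of the first component produces this increment with the
    favourable sign, so it may be dropped.\<close>
  have "0 \<le> A 1 1 (p - r) (p - r)" by (simp add: A.nonneg)
  moreover have "A 1 1 (p - r) (p - r) = A 1 1 p p - 2 * A 1 1 p r + A 1 1 r r"
    by (simp add: A.diff_left A.diff_right A.commute[of 1 1 r p])
  \<comment> \<open>The explicit treatment of the second component produces this increment with the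
    wrong sign; the step size restriction bounds it by mass.\<close>
  moreover have "A 2 2 (q - s) (q - s) \<le> (1 - g) * m 2 2 (q - s) (q - s) / \<tau>"
    using cfl[OF mem_diff(2)] \<tau> by (simp add: field_simps)
  moreover have "A 2 2 (q - s) (q - s) = A 2 2 q q - 2 * A 2 2 s q + A 2 2 s s"
    by (simp add: A.diff_left A.diff_right A.commute[of 2 2 q s])
  moreover have "0 \<le> (1 - g) * m 1 1 (p - r) (p - r) / \<tau>"
    using g \<tau> by (simp add: m.nonneg)
  moreover have "2 * \<bar>m 1 2 (s - s') (p - r)\<bar> / \<tau>
      \<le> (g * m 2 2 (s - s') (s - s') + m 1 1 (p - r) (p - r)) / \<tau>"
    using \<tau> young(1) by (intro divide_right_mono) auto
  moreover have "2 * \<bar>m 1 2 (q - s) (r - r')\<bar> / \<tau>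
      \<le> (m 2 2 (q - s) (q - s) + g * m 1 1 (r - r') (r - r')) / \<tau>"
    using \<tau> young(2) by (intro divide_right_mono) auto
  moreover have "- (2 * \<bar>m 1 2 (s - s') (p - r)\<bar> / \<tau>) \<le> 2 * m 1 2 (s - s') (p - r) / \<tau>"
    "- (2 * \<bar>m 1 2 (q - s) (r - r')\<bar> / \<tau>) \<le> 2 * m 1 2 (q - s) (r - r') / \<tau>"
    using \<tau> by (auto simp: field_simps)
  \<comment> \<open>In twice the sum of \<open>1\<close> and \<open>2\<close>, the new increments
    carry mass with factor \<open>2 / \<tau>\<close>. Young's inequality uses
    \<open>1 / \<tau>\<close> of it, \<open>g / \<tau>\<close> is kept on the left, and the
    remaining \<open>(1 - g) / \<tau>\<close> absorbs the explicit energy increment in the second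
    component and is dropped in the first.\<close>
  ultimately have "g / \<tau> * (m 1 1 (p - r) (p - r) + m 2 2 (q - s) (q - s))
      + (A 1 1 p p + A 1 2 q p + (A 1 2 q p + A 2 2 q q))
    \<le> g / \<tau> * (m 1 1 (r - r') (r - r') + m 2 2 (s - s') (s - s'))
      + (A 1 1 r r + A 1 2 s r + (A 1 2 s r + A 2 2 s s))"
    using 1 2 by (simp add: algebra_simps add_divide_distrib diff_divide_distrib)
  then show ?thesis
    unfolding p_def[symmetric] q_def[symmetric] r_def[symmetric] s_def[symmetric] r'_def[symmetric] s'_def[symmetric]
    by (simp add: p_def[symmetric] q_def[symmetric] r_def[symmetric] s_def[symmetric] r'_def[symmetric]
        s'_def[symmetric] A.commute[of 2 1])
qed

section \<open>The multicontinuum forms\<close>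

context
  fixes M :: "('d::finite) multicontinuum"
  assumes setting: "multicontinuum_setting M"
begin

lemma part_subset: "j \<in> {1, 2} \<Longrightarrow> part M j \<subseteq> {1..ncont M}"
  using setting unfolding multicontinuum_setting_def by auto

text \<open>Each weak gradient is additive off a null set, and finitely many continua contribute
  only finitely many such sets. \<open>T0\<close> contains no derivative of its argument, so its
  counterpart \<open>T0_lincomb\<close> holds at every point.\<close>

lemma T1_lincomb_AE:
  assumes j: "j \<in> {1, 2}" and U: "U \<in> prod_space M j" and W: "W \<in> prod_space M j"
  shows "AE x in lebesgue. x \<in> omega M \<longrightarrow>
    T1 M j (\<lambda>k x. r * U k x + s * W k x) x = r * T1 M j U x + s * T1 M j W x"
proof -
  let ?w = "weak_gradient (omega M)"
  have fin: "finite (part M j)" using part_subset[OF j] finite_subset by blast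
  have H1: "U i \<in> H1 (omega M)" "W i \<in> H1 (omega M)" if "i \<in> part M j" for i
    using that U W setting unfolding prod_space_def multicontinuum_setting_def by auto
  have "AE x in lebesgue. \<forall>i\<in>part M j. x \<in> omega M \<longrightarrow>
      ?w (\<lambda>x. r * U i x + s * W i x) x = r *\<^sub>R ?w (U i) x + s *\<^sub>R ?w (W i) x"
    using H1 by (intro AE_finite_allI fin weak_gradient_lincomb_AE open_omega[OF setting]) auto
  then show ?thesis
  proof eventually_elim
    case (elim x)
    then show ?case
      unfolding T1_def
      by (auto simp: sum_distrib_left sum.distrib[symmetric] inner_add_right algebra_simps intro!: sum.cong)
  qed
qed

lemma T_lincomb_AE:
  assumes "j \<in> {1, 2}" "U \<in> prod_space M j" "W \<in> prod_space M j"
  shows "AE x in lebesgue. x \<in> omega M \<longrightarrow>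
    T M j (\<lambda>k x. r * U k x + s * W k x) x = r * T M j U x + s * T M j W x"
  using T1_lincomb_AE[OF assms, of r s]
  by (rule AE_mp) (auto simp: T_def T0_lincomb algebra_simps)

context
  fixes V :: "nat \<Rightarrow> (nat \<Rightarrow> real^'d \<Rightarrow> real) set"
  assumes coarse: "\<And>j. j \<in> {1, 2} \<Longrightarrow> coarse_space M j (V j)"
begin

section \<open>The forms on the coarse spaces, the constant gamma and the step size
  restriction\<close>

lemma coarse_subspace: "j \<in> {1, 2} \<Longrightarrow> vector_fun.subspace (V j)"
  using coarse vector_fun.subspace_span unfolding coarse_space_def by metis

lemma coarse_prod_space: "j \<in> {1, 2} \<Longrightarrow> U \<in> V j \<Longrightarrow> U \<in> prod_space M j"
  using coarse unfolding coarse_space_def by blast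

lemma coarse_sq_integrable: "j \<in> {1, 2} \<Longrightarrow> U \<in> V j \<Longrightarrow> sq_integrable (omega M) (T M j U)"
  using coarse unfolding coarse_space_def by blast

lemma coarse_piecewise_H1:
  assumes "j \<in> {1, 2}" "U \<in> V j"
  shows "piecewise_H1 M (T0 M j U)" "piecewise_H1 M (T1 M j U)"
  using coarse[OF assms(1)] assms(2) setting unfolding coarse_space_def by (auto simp: piecewise_H1_def)

lemma psd_forms_mform: "psd_forms V (mform M)"
  unfolding mform_def
  by unfold_locales
     (auto intro!: coarse_subspace L2_inner_lincomb[OF setting] coarse_sq_integrable T_lincomb_AE
        coarse_prod_space L2_inner_commute L2_inner_nonneg)

text \<open>The scheme, the step size restriction and the final norms contain the forms a and c only
  through their sum, so the sum is treated as one form.\<close>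

lemma psd_forms_acform: "psd_forms V (\<lambda>i j U W. aform M i j U W + cform M i j U W)"
proof
  fix i j :: nat and U U' W r s
  assume *: "i \<in> {1, 2}" "j \<in> {1, 2}" "U \<in> V j" "U' \<in> V j" "W \<in> V i"
  have "aform M i j (\<lambda>k x. r * U k x + s * U' k x) W = r * aform M i j U W + s * aform M i j U' W"
    unfolding aform_def
    by (intro energy_lincomb[OF setting] coarse_piecewise_H1 * T1_lincomb_AE coarse_prod_space)
  moreover have "cform M i j (\<lambda>k x. r * U k x + s * U' k x) W = r * cform M i j U W + s * cform M i j U' W"
    unfolding cform_def
    by (intro energy_lincomb[OF setting] coarse_piecewise_H1 * AE_I2 impI T0_lincomb)
  ultimately show "aform M i j (\<lambda>k x. r * U k x + s * U' k x) W + cform M i j (\<lambda>k x. r * U k x + s * U' k x) W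
      = r * (aform M i j U W + cform M i j U W) + s * (aform M i j U' W + cform M i j U' W)"
    by (simp add: algebra_simps)
next
  show "vector_fun.subspace (V j)" if "j \<in> {1, 2}" for j using that by (rule coarse_subspace)
  show "aform M i j U W + cform M i j U W = aform M j i W U + cform M j i W U" for i j U W
    unfolding aform_def cform_def by (simp add: energy_commute)
  show "0 \<le> aform M i i W W + cform M i i W W" for i W
    unfolding aform_def cform_def by (intro add_nonneg_nonneg energy_nonneg[OF setting])
qed

lemma quotient_bounded:
  assumes "U1 \<in> V 1" "U2 \<in> V 2"
  shows "L2_inner M (T M 1 U1) (T M 2 U2) / (L2_norm M (T M 1 U1) * L2_norm M (T M 2 U2)) \<le> 1"
proof -
  have "\<bar>L2_inner M (T M 1 U1) (T M 2 U2)\<bar> \<le> L2_norm M (T M 1 U1) * L2_norm M (T M 2 U2)"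
    using assms by (intro L2_inner_Cauchy_Schwarz[OF setting] coarse_sq_integrable) auto
  then show ?thesis
    by (smt (verit) abs_ge_self abs_ge_zero divide_le_eq_1_pos div_by_0)
qed

text \<open>The inserted 0 gives the lower bound. By Cauchy-Schwarz the quotients are at most 1, so
  the set is bounded above and \<open>Sup\<close> is a genuine supremum.\<close>

lemma gamma_const_bounds: "0 \<le> gamma_const M V" "gamma_const M V \<le> 1"
proof -
  show "0 \<le> gamma_const M V"
    unfolding gamma_const_def using quotient_bounded by (intro cSup_upper bdd_aboveI[of _ 1]) auto
  show "gamma_const M V \<le> 1"
    unfolding gamma_const_def using quotient_bounded by (intro cSup_least) auto
qed

text \<open>The supremum runs over signed quotients; the bound on the absolute value comes from
  applying it to \<open>W2\<close> and to its negative, which lies in the same subspace.\<close>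

lemma mform_le_gamma_const:
  assumes W1: "W1 \<in> V 1" and W2: "W2 \<in> V 2"
  shows "\<bar>mform M 1 2 W2 W1\<bar> \<le> gamma_const M V * (L2_norm M (T M 1 W1) * L2_norm M (T M 2 W2))"
proof -
  interpret m: psd_forms V "mform M" by (rule psd_forms_mform)
  let ?P = "L2_norm M (T M 1 W1) * L2_norm M (T M 2 W2)"
  have eq: "mform M 1 2 W2 W1 = L2_inner M (T M 1 W1) (T M 2 W2)"
    unfolding mform_def by (rule L2_inner_commute)
  have CS: "\<bar>mform M 1 2 W2 W1\<bar> \<le> ?P"
    unfolding eq using assms by (intro L2_inner_Cauchy_Schwarz[OF setting] coarse_sq_integrable) auto
  show ?thesis
  proof (cases "?P = 0")
    case True
    \<comment> \<open>A pair with zero denominator is excluded from the supremum, but there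
      Cauchy-Schwarz makes the mixed term itself vanish.\<close>
    show ?thesis using CS unfolding True by simp
  next
    case False
    then have pos: "?P > 0" using order_trans[OF abs_ge_zero CS] by linarith
    \<comment> \<open>The negative is written as a linear combination so that
      \<open>lincomb_left\<close> applies. Since \<open>T\<close> is known to be linear only almost
      everywhere, signs are moved at the level of the forms.\<close>
    let ?N = "\<lambda>k x. (-1) * W2 k x + 0 * W2 k x"
    have N: "?N \<in> V 2"
      using vector_fun.subspace_scale[OF coarse_subspace W2, of "-1"] by simp
    have neg: "mform M i 2 ?N W = - mform M i 2 W2 W" if "i \<in> {1, 2}" "W \<in> V i" for i W
      using m.lincomb_left[of i 2 W2 W2 W "-1" 0] that W2 by simp
    have "mform M 2 2 ?N ?N = mform M 2 2 W2 W2"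
      using neg[of 2 ?N] neg[of 2 W2] N W2 m.commute[of 2 2 ?N W2] by simp
    then have norm: "L2_norm M (T M 2 ?N) = L2_norm M (T M 2 W2)"
      unfolding L2_norm_def mform_def by simp
    have le: "L2_inner M (T M 1 U1) (T M 2 U2) / (L2_norm M (T M 1 U1) * L2_norm M (T M 2 U2)) \<le> gamma_const M V"
      if "U1 \<in> V 1" "U2 \<in> V 2" "L2_norm M (T M 1 U1) * L2_norm M (T M 2 U2) \<noteq> 0" for U1 U2
      unfolding gamma_const_def using quotient_bounded that
      by (intro cSup_upper bdd_aboveI[of _ 1]) auto
    have "mform M 1 2 W2 W1 \<le> gamma_const M V * ?P"
      using le[OF W1 W2 False] pos unfolding eq by (simp add: pos_divide_le_eq)
    moreover have "L2_inner M (T M 1 W1) (T M 2 ?N) = - mform M 1 2 W2 W1"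
      using neg[of 1 W1] W1 L2_inner_commute[of M "T M 1 W1"] unfolding mform_def by simp
    moreover have "L2_inner M (T M 1 W1) (T M 2 ?N) \<le> gamma_const M V * ?P"
      using le[OF W1 N, unfolded norm, OF False] by (simp only: pos_divide_le_eq[OF pos])
    ultimately show ?thesis by linarith
  qed
qed

text \<open>The factor gamma in the product of gamma and the two norms may be attached to either
  norm before Young's inequality; the two choices give the two bounds.\<close>

lemma young_mform:
  assumes W1: "W1 \<in> V 1" and W2: "W2 \<in> V 2"
  shows "2 * \<bar>mform M 1 2 W2 W1\<bar> \<le> (gamma_const M V)\<^sup>2 * mform M 2 2 W2 W2 + mform M 1 1 W1 W1"
    and "2 * \<bar>mform M 1 2 W2 W1\<bar> \<le> mform M 2 2 W2 W2 + (gamma_const M V)\<^sup>2 * mform M 1 1 W1 W1"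
proof -
  let ?g = "gamma_const M V" and ?x = "L2_norm M (T M 1 W1)" and ?y = "L2_norm M (T M 2 W2)"
  have "2 * \<bar>mform M 1 2 W2 W1\<bar> \<le> 2 * ?g * ?x * ?y"
    using mform_le_gamma_const[OF assms] by simp
  moreover have "2 * ?g * ?x * ?y \<le> (?g * ?y)\<^sup>2 + ?x\<^sup>2" "2 * ?g * ?x * ?y \<le> ?y\<^sup>2 + (?g * ?x)\<^sup>2"
    using sum_squares_bound[of "?g * ?y" ?x] sum_squares_bound[of ?y "?g * ?x"]
    by (simp_all add: mult_ac)
  ultimately show "2 * \<bar>mform M 1 2 W2 W1\<bar> \<le> ?g\<^sup>2 * mform M 2 2 W2 W2 + mform M 1 1 W1 W1"
    "2 * \<bar>mform M 1 2 W2 W1\<bar> \<le> mform M 2 2 W2 W2 + ?g\<^sup>2 * mform M 1 1 W1 W1"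
    unfolding mform_def L2_norm_power2[symmetric] power_mult_distrib by linarith+
qed

text \<open>This clears the denominator in the step size restriction, which needs a nonnegative
  prefactor and hence gamma at most 1.\<close>

lemma le_mult_inf_quotient:
  assumes \<tau>: "ereal \<tau> \<le> ereal (1 - (gamma_const M V)\<^sup>2) * inf_quotient M (V 2)" and W: "W \<in> V 2"
  shows "\<tau> * (aform M 2 2 W W + cform M 2 2 W W) \<le> (1 - (gamma_const M V)\<^sup>2) * mform M 2 2 W W"
proof -
  interpret m: psd_forms V "mform M" by (rule psd_forms_mform)
  interpret A: psd_forms V "\<lambda>i j U W. aform M i j U W + cform M i j U W" by (rule psd_forms_acform)
  let ?A = "aform M 2 2 W W + cform M 2 2 W W"
  have g: "0 \<le> 1 - (gamma_const M V)\<^sup>2"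
    using gamma_const_bounds by (simp add: power_le_one)
  show ?thesis
  proof (cases "?A = 0")
    \<comment> \<open>Functions of zero energy do not enter the infimum; for them the left side is 0
      and the right side is nonnegative.\<close>
    case True
    then show ?thesis using g m.nonneg[of 2 W] W by simp
  next
    case False
    then have "?A > 0" using A.nonneg[of 2 W] W by simp
    have "inf_quotient M (V 2) \<le> ereal (mform M 2 2 W W / ?A)"
      unfolding inf_quotient_def using False W by (intro INF_lower) auto
    then have "ereal (1 - (gamma_const M V)\<^sup>2) * inf_quotient M (V 2)
        \<le> ereal (1 - (gamma_const M V)\<^sup>2) * ereal (mform M 2 2 W W / ?A)"
      using g by (intro ereal_mult_left_mono) auto
    from order_trans[OF \<tau> this] have "\<tau> \<le> (1 - (gamma_const M V)\<^sup>2) * mform M 2 2 W W / ?A"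
      by simp
    then show ?thesis by (simp only: pos_le_divide_eq[OF \<open>?A > 0\<close>])
  qed
qed

end

end

theorem theorem3:
  fixes M :: "('d::finite) multicontinuum"
    and V :: "nat \<Rightarrow> (nat \<Rightarrow> real^'d \<Rightarrow> real) set"
    and U :: "nat \<Rightarrow> nat \<Rightarrow> nat \<Rightarrow> real^'d \<Rightarrow> real"
    and \<tau> :: real
  assumes setting: "multicontinuum_setting M"
    and coarse: "\<And>j. j \<in> {1, 2} \<Longrightarrow> coarse_space M j (V j)"
    and tau_pos: "\<tau> > 0"
    and U_in: "\<And>j n. j \<in> {1, 2} \<Longrightarrow> U j n \<in> V j"
    and scheme1: "\<And>n W. n \<ge> 1 \<Longrightarrow> W \<in> V 1 \<Longrightarrow>
        mform M 1 1 (diff_quot \<tau> (U 1 (n + 1)) (U 1 n)) W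
      + mform M 1 2 (diff_quot \<tau> (U 2 n) (U 2 (n - 1))) W
      + aform M 1 1 (U 1 (n + 1)) W + aform M 1 2 (U 2 n) W
      + cform M 1 1 (U 1 (n + 1)) W + cform M 1 2 (U 2 n) W = 0"
    and scheme2: "\<And>n W. n \<ge> 1 \<Longrightarrow> W \<in> V 2 \<Longrightarrow>
        mform M 2 2 (diff_quot \<tau> (U 2 (n + 1)) (U 2 n)) W
      + mform M 2 1 (diff_quot \<tau> (U 1 n) (U 1 (n - 1))) W
      + aform M 2 1 (U 1 (n + 1)) W + aform M 2 2 (U 2 n) W
      + cform M 2 1 (U 1 (n + 1)) W + cform M 2 2 (U 2 n) W = 0"
    and tau_le: "ereal \<tau> \<le> ereal (1 - (gamma_const M V)\<^sup>2) * inf_quotient M (V 2)"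
  shows "\<forall>n\<ge>1.
      (gamma_const M V)\<^sup>2 / \<tau> *
        (\<Sum>i\<in>{1,2}. mform M i i (U i (n + 1) - U i n) (U i (n + 1) - U i n))
      + anorm2 M (\<lambda>i. U i (n + 1)) + cnorm2 M (\<lambda>i. U i (n + 1))
    \<le> (gamma_const M V)\<^sup>2 / \<tau> *
        (\<Sum>i\<in>{1,2}. mform M i i (U i n - U i (n - 1)) (U i n - U i (n - 1)))
      + anorm2 M (\<lambda>i. U i n) + cnorm2 M (\<lambda>i. U i n)"
proof (intro allI impI)
  fix n :: nat
  assume n: "n \<ge> 1"
  have sum: "anorm2 M W + cnorm2 M W
      = (\<Sum>i\<in>{1,2}. \<Sum>j\<in>{1,2}. aform M i j (W j) (W i) + cform M i j (W j) (W i))" for W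
    unfolding anorm2_def cnorm2_def by (simp add: sum.distrib)
  have "(gamma_const M V)\<^sup>2 / \<tau> *
        (\<Sum>i\<in>{1,2}. mform M i i (U i (n + 1) - U i n) (U i (n + 1) - U i n))
      + (anorm2 M (\<lambda>i. U i (n + 1)) + cnorm2 M (\<lambda>i. U i (n + 1)))
    \<le> (gamma_const M V)\<^sup>2 / \<tau> *
        (\<Sum>i\<in>{1,2}. mform M i i (U i n - U i (n - 1)) (U i n - U i (n - 1)))
      + (anorm2 M (\<lambda>i. U i n) + cnorm2 M (\<lambda>i. U i n))"
    unfolding sum
  \<comment> \<open>The abstract step is used with \<open>g\<close> the square of gamma; the
    assumption \<open>n \<ge> 1\<close> makes the scheme available and \<open>n - 1\<close> a true
    predecessor.\<close>
  proof (rule energy_step[OF psd_forms_mform[OF setting coarse] psd_forms_acform[OF setting coarse] tau_pos _ U_in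
        young_mform(1)[OF setting coarse] young_mform(2)[OF setting coarse]])
    show "(gamma_const M V)\<^sup>2 \<le> 1"
      using gamma_const_bounds[OF setting coarse] by (simp add: power_le_one)
    show "\<tau> * (aform M 2 2 W W + cform M 2 2 W W) \<le> (1 - (gamma_const M V)\<^sup>2) * mform M 2 2 W W"
      if "W \<in> V 2" for W
      by (rule le_mult_inf_quotient[OF setting coarse tau_le that])
    show "mform M 1 1 (diff_quot \<tau> (U 1 (n + 1)) (U 1 n)) W
        + mform M 1 2 (diff_quot \<tau> (U 2 n) (U 2 (n - 1))) W
        + (aform M 1 1 (U 1 (n + 1)) W + cform M 1 1 (U 1 (n + 1)) W)
        + (aform M 1 2 (U 2 n) W + cform M 1 2 (U 2 n) W) = 0" if "W \<in> V 1" for W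
      using scheme1[OF n that] by linarith
    show "mform M 2 2 (diff_quot \<tau> (U 2 (n + 1)) (U 2 n)) W
        + mform M 2 1 (diff_quot \<tau> (U 1 n) (U 1 (n - 1))) W
        + (aform M 2 1 (U 1 (n + 1)) W + cform M 2 1 (U 1 (n + 1)) W)
        + (aform M 2 2 (U 2 n) W + cform M 2 2 (U 2 n) W) = 0" if "W \<in> V 2" for W
      using scheme2[OF n that] by linarith
  qed
  then show "(gamma_const M V)\<^sup>2 / \<tau> *
        (\<Sum>i\<in>{1,2}. mform M i i (U i (n + 1) - U i n) (U i (n + 1) - U i n))
      + anorm2 M (\<lambda>i. U i (n + 1)) + cnorm2 M (\<lambda>i. U i (n + 1))
    \<le> (gamma_const M V)\<^sup>2 / \<tau> *
        (\<Sum>i\<in>{1,2}. mform M i i (U i n - U i (n - 1)) (U i n - U i (n - 1)))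
      + anorm2 M (\<lambda>i. U i n) + cnorm2 M (\<lambda>i. U i n)"
    by (simp add: add.assoc)
qed

end
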